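(* Let $d\ge2$, $2<p<q<\infty$, $R\ge10$, $f\in L^2(B_R)$, $u\in H^1(B_R)$, and let $\mathcal{K}:\mathbb{R}^d\to[1,\infty)$ be a measurable function. Assume that for every $r\in[4,R/2]$ and $x_0\in B_{R/2}$, $$\inf_{v\in\mathcal{A}(B_{r/2}(x_0),\,\mathcal{K})}\ \frac{1}{|B_{r/2}(x_0)|}\int_{B_{r/2}(x_0)}|\nabla u(x)-\nabla v(x)|^2\,dx\ \le\ \frac{1}{|B_r(x_0)|}\int_{B_r(x_0)}|f(x)|^2\,dx .$$ Then there exists a constant $C=C(d,p,q)\ge1$ (depending only on $d,p,q$) such that, for every $t>0$, $$\left|\left\{x\in B_{R/2}:\ \mathcal{M}_1(|\nabla u|^2)(x)>t\right\}\right|\ \le\ C\,|B_{R/2}|\left(\frac{t}{t_*}\right)^{-\frac p2(1-\theta)}\left\|\mathcal{K}^{q/2}\right\|_{\underline{L}^1_1(B_R)}^{\theta},$$ where the exponent $\theta\in(0,1)$ is $$\theta:=\frac{p^2+2p}{p^2+2q}$$ and $$t_*:=\left\||\nabla u|^2\right\|_{\underline{L}^1_1(B_R)}+\left\|f^2\right\|_{\underline{L}^{p/2}_1(B_R)} .$$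
   Context: $B_r(x)$ is the Euclidean ball in $\mathbb{R}^d$ of radius $r$ centered at $x$, and $B_r:=B_r(0)$; $|U|$ is Lebesgue measure. The class $\mathcal{A}$. For a measurable function $\mathcal{K}:\mathbb{R}^d\to[0,\infty)$ and a ball $B_{2\rho}(x_0)$ of radius $2\rho\ge2$, $\mathcal{A}(B_{2\rho}(x_0),\mathcal{K})$ is the set of $v\in H^1(B_{2\rho}(x_0))$ such that for every $x\in B_\rho(x_0)$, $$\frac1{|B_1(x)|}\int_{B_1(x)}|\nabla v(y)|^2\,dy\ \le\ \mathcal{K}(x)\,\frac{1}{|B_{2\rho}(x_0)|}\int_{B_{2\rho}(x_0)}|\nabla v(y)|^2\,dy .$$ Coarsened norms. For $h>0$, $s\in[1,\infty)$, $\varphi\in L^1_{\mathrm{loc}}(\mathbb{R}^d)$ and $U\subseteq\mathbb{R}^d$ of finite positive measure, $$\|\varphi\|_{\underline{L}^s_h(U)}:=\left(\frac1{|U|}\int_U\left(\frac1{|B_h(x)|}\int_{B_h(x)}|\varphi(y)|\,dy\right)^s dx\right)^{1/s}.$$ Coarsened maximal function. For $h\ge0$ and $\varphi\in L^1_{\mathrm{loc}}(\mathbb{R}^d)$, $$\mathcal{M}_h(\varphi)(x):=\sup_{r>h}\frac1{|B_r(x)|}\int_{B_r(x)}|\varphi(y)|\,dy .$$ Functions defined only on $B_R$ (such as $|\nabla u|^2$ and $f^2$) are extended by $0$ to $\mathbb{R}^d$ when computing $\mathcal{M}_h$ and the coarsened norms. *)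

theory Defs
  imports "HOL-Analysis.Analysis"
begin

section \<open>Sobolev functions\<close>

primrec C_k :: "nat \<Rightarrow> ('a::euclidean_space \<Rightarrow> real) \<Rightarrow> bool" where
  "C_k 0 \<phi> \<longleftrightarrow> continuous_on UNIV \<phi>"
| "C_k (Suc k) \<phi> \<longleftrightarrow> (\<forall>x. \<phi> differentiable (at x)) \<and>
     (\<forall>i\<in>Basis. C_k k (\<lambda>x. frechet_derivative \<phi> (at x) i))"

definition test_functions :: "'a::euclidean_space set \<Rightarrow> ('a \<Rightarrow> real) set" where
  "test_functions U =
     {\<phi>. (\<forall>k. C_k k \<phi>) \<and> compact (closure {x. \<phi> x \<noteq> 0}) \<and> closure {x. \<phi> x \<noteq> 0} \<subseteq> U}"

definition has_weak_gradient ::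
  "'a::euclidean_space set \<Rightarrow> ('a \<Rightarrow> real) \<Rightarrow> ('a \<Rightarrow> 'a) \<Rightarrow> bool" where
  "has_weak_gradient U u g \<longleftrightarrow>
     (\<forall>S. compact S \<and> S \<subseteq> U \<longrightarrow> set_integrable lebesgue S u \<and> set_integrable lebesgue S g) \<and>
     (\<forall>\<phi>\<in>test_functions U. \<forall>i\<in>Basis.
        (LINT x|lebesgue_on U. u x * frechet_derivative \<phi> (at x) i)
          = - (LINT x|lebesgue_on U. (g x \<bullet> i) * \<phi> x))"

text \<open>A representative of the weak gradient, which is unique up to a null subset of \<open>U\<close>.
  Its values outside \<open>U\<close> carry no meaning.\<close>

definition weak_grad :: "'a::euclidean_space set \<Rightarrow> ('a \<Rightarrow> real) \<Rightarrow> 'a \<Rightarrow> 'a" where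
  "weak_grad U u = (SOME g. has_weak_gradient U u g)"

definition L2 :: "'a::euclidean_space set \<Rightarrow> ('a \<Rightarrow> 'b::euclidean_space) set" where
  "L2 U = {f. f \<in> borel_measurable (lebesgue_on U) \<and>
              integrable (lebesgue_on U) (\<lambda>x. (norm (f x))\<^sup>2)}"

definition H1 :: "'a::euclidean_space set \<Rightarrow> ('a \<Rightarrow> real) set" where
  "H1 U = {u. u \<in> L2 U \<and> has_weak_gradient U u (weak_grad U u) \<and> weak_grad U u \<in> L2 U}"

section \<open>Averages, coarsened norms and maximal functions\<close>

text \<open>Averages, norms and maximal functions take values in \<open>[0, \<infinity>]\<close>; no local integrability
  is needed to form them.\<close>

definition avg :: "'a::euclidean_space set \<Rightarrow> ('a \<Rightarrow> ennreal) \<Rightarrow> ennreal" where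
  "avg U g = (\<integral>\<^sup>+y\<in>U. g y \<partial>lebesgue) / emeasure lebesgue U"

text \<open>Real powers on \<open>[0, \<infinity>]\<close>: \<open>\<infinity>\<^sup>a = \<infinity>\<close> and \<open>0\<^sup>a = 0\<close> for \<open>a > 0\<close>, \<open>x\<^sup>0 = 1\<close>, and
  \<open>x\<^sup>a = 1 / x\<^sup>-\<^sup>a\<close> for \<open>a < 0\<close>.\<close>

definition epowr :: "ennreal \<Rightarrow> real \<Rightarrow> ennreal" where
  "epowr x a =
     (let pos = (\<lambda>b. if x = \<infinity> then \<infinity> else ennreal (enn2real x powr b))
      in if a = 0 then 1 else if 0 < a then pos a else inverse (pos (- a)))"

definition coarse_norm ::
  "real \<Rightarrow> real \<Rightarrow> 'a::euclidean_space set \<Rightarrow> ('a \<Rightarrow> real) \<Rightarrow> ennreal" where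
  "coarse_norm h s U \<phi> =
     epowr (avg U (\<lambda>x. epowr (avg (ball x h) (\<lambda>y. ennreal \<bar>\<phi> y\<bar>)) s)) (1 / s)"

definition coarse_maximal ::
  "real \<Rightarrow> ('a::euclidean_space \<Rightarrow> real) \<Rightarrow> 'a \<Rightarrow> ennreal" where
  "coarse_maximal h \<phi> x = (SUP r\<in>{h<..}. avg (ball x r) (\<lambda>y. ennreal \<bar>\<phi> y\<bar>))"

definition zero_ext :: "'a set \<Rightarrow> ('a \<Rightarrow> real) \<Rightarrow> 'a \<Rightarrow> real" where
  "zero_ext U \<phi> x = (if x \<in> U then \<phi> x else 0)"

section \<open>The class \<open>\<A>\<close>\<close>

text \<open>The radius \<open>s\<close> is that of the large ball, \<open>s = 2\<rho> \<ge> 2\<close>, so that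
  \<open>B\<^sub>1(x) \<subseteq> B\<^sub>s(x\<^sub>0)\<close> for \<open>x \<in> B\<^sub>s\<^sub>/\<^sub>2(x\<^sub>0)\<close> and only values of the gradient inside
  \<open>B\<^sub>s(x\<^sub>0)\<close> enter. The function \<open>K\<close> is meant to be nonnegative.\<close>

definition class_A ::
  "'a::euclidean_space \<Rightarrow> real \<Rightarrow> ('a \<Rightarrow> real) \<Rightarrow> ('a \<Rightarrow> real) set" where
  "class_A x0 s K =
     {v \<in> H1 (ball x0 s). \<forall>x\<in>ball x0 (s / 2).
        avg (ball x 1) (\<lambda>y. ennreal ((norm (weak_grad (ball x0 s) v y))\<^sup>2))
          \<le> ennreal (K x) * avg (ball x0 s) (\<lambda>y. ennreal ((norm (weak_grad (ball x0 s) v y))\<^sup>2))}"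

end

theory Submission
  imports Defs
begin

text \<open>
The proof is a Calderon--Zygmund iteration over the level sets
\<open>E\<^sub>t = {x \<in> B\<^sub>R\<^sub>/\<^sub>2. M\<^sub>1(|\<nabla>u|\<^sup>2)(x) > t}\<close>. Every point of \<open>E\<^sub>t\<close> has a largest scale, up to a factor of two,
at which the average of \<open>|\<nabla>u|\<^sup>2\<close> exceeds \<open>t\<close>; if \<open>t\<close> is a large multiple of \<open>t\<^sub>*\<close> this stopping radius is
small compared with \<open>R\<close>. On a fixed multiple of the stopping ball \<open>\<nabla>u\<close> is compared with the gradient
of some \<open>v\<close> in the class \<open>\<A>\<close>. Passing from level \<open>t\<close> to level \<open>\<Lambda> t\<close> is then possible only for three
reasons: the data \<open>f\<^sup>2\<close> have average above \<open>\<epsilon> t\<close> near the ball, or \<open>K\<close> has a local average above \<open>\<Lambda>\<close>,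
or \<open>|\<nabla>u - \<nabla>v|\<^sup>2\<close>, whose average is at most of order \<open>\<epsilon> t\<close>, has a local average of order \<open>\<Lambda> t\<close>. Vitali's lemma
(\<open>covering_estimate\<close>) turns each of them into a measure estimate, and up to constants, also in
the levels,

  \<open>|E\<^bsub>\<Lambda>t\<^esub>| \<le> (\<kappa> \<Lambda>\<^bsup>-q/2\<^esup> + (\<epsilon> t / t\<^sub>*)\<^bsup>-p/2\<^esup>) |B\<^sub>R\<^sub>/\<^sub>2| + (\<epsilon> / \<Lambda>) |E\<^sub>t|\<close>

where \<open>\<kappa>\<close> is the coarsened norm of \<open>K\<^bsup>q/2\<^esup>\<close> (\<open>good_ball\<close> and \<open>level_set_step\<close>). The term with \<open>K\<close> does not
carry a factor \<open>|E\<^sub>t|\<close>: \<open>K\<^bsup>q/2\<^esup>\<close> is integrable only on the large scale. A fixed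
jump \<open>\<Lambda>\<close> would therefore give no decay, and \<open>\<Lambda>\<close> has to grow like a power of the level.

With \<open>\<tau> = \<Lambda> t / t\<^sub>*\<close> and \<open>s = (p / 2) (1 - \<theta>)\<close>, the first two terms have the size \<open>\<kappa>\<^bsup>\<theta>\<^esup> \<tau>\<^bsup>-s\<^esup>\<close> exactly when
\<open>\<Lambda> = Z\<^bsup>2s/q\<^esup>\<close> and \<open>\<epsilon> = \<Lambda> Z\<^bsup>-\<theta>\<^esup>\<close>, where \<open>Z = \<kappa>\<^bsup>2/p\<^esup> \<tau>\<close>. Under the induction hypothesis
\<open>|E\<^sub>t| \<le> C \<kappa>\<^bsup>\<theta>\<^esup> (t / t\<^sub>*)\<^bsup>-s\<^esup> |B\<^sub>R\<^sub>/\<^sub>2|\<close> the last term is then bounded by the same quantity, because the value of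
\<open>\<theta>\<close> satisfies \<open>2 s\<^sup>2 / q \<le> \<theta>\<close> (\<open>decay_exponent\<close> and \<open>iteration_parameters\<close>). The induction over levels
(\<open>level_set_decay\<close>) starts from the range of small \<open>\<tau>\<close> where the claim is weaker than
\<open>|E\<^sub>t| \<le> |B\<^sub>R\<^sub>/\<^sub>2|\<close>.
\<close>

section \<open>Averages over balls\<close>

lemma emeasure_ball_scale:
  assumes "0 \<le> c" "0 \<le> r"
  shows "emeasure lebesgue (ball (x::'a::euclidean_space) (c * r))
    = ennreal (c ^ DIM('a)) * emeasure lebesgue (ball (y::'a) r)"
  using assms
  by (simp add: emeasure_ball power_mult_distrib ennreal_mult[symmetric] mult_ac)

lemma emeasure_ball_pos_finite:
  assumes "0 < r"
  shows "emeasure lebesgue (ball (x::'a::euclidean_space) r) \<noteq> 0"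
    and "emeasure lebesgue (ball (x::'a::euclidean_space) r) < top"
  using assms unit_ball_vol_pos[of "real DIM('a)"] by (auto simp: emeasure_ball simp del: unit_ball_vol_pos)

lemma avg_ball_times:
  assumes "0 < r"
  shows "avg (ball (x::'a::euclidean_space) r) g * emeasure lebesgue (ball x r)
    = (\<integral>\<^sup>+y\<in>ball x r. g y \<partial>lebesgue)"
  unfolding avg_def using emeasure_ball_pos_finite[OF assms, of x]
  by (simp add: ennreal_divide_times)

lemma avg_ball_le_iff:
  assumes "0 < r"
  shows "avg (ball (x::'a::euclidean_space) r) g \<le> c
    \<longleftrightarrow> (\<integral>\<^sup>+y\<in>ball x r. g y \<partial>lebesgue) \<le> c * emeasure lebesgue (ball x r)"
    (is "_ \<longleftrightarrow> ?I \<le> c * ?v")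
proof
  assume "avg (ball x r) g \<le> c"
  then show "?I \<le> c * ?v"
    unfolding avg_ball_times[OF assms, symmetric] by (rule mult_right_mono) simp
next
  assume "?I \<le> c * ?v"
  then have "avg (ball x r) g \<le> c * ?v / ?v"
    unfolding avg_def by (rule divide_right_mono_ennreal)
  also have "\<dots> = c"
    using emeasure_ball_pos_finite[OF assms, of x]
    by (simp add: ennreal_divide_times ennreal_times_divide[symmetric])
  finally show "avg (ball x r) g \<le> c" .
qed

lemma avg_ball_less_iff:
  assumes "0 < r"
  shows "avg (ball (x::'a::euclidean_space) r) g < c
    \<longleftrightarrow> (\<integral>\<^sup>+y\<in>ball x r. g y \<partial>lebesgue) < c * emeasure lebesgue (ball x r)"
  unfolding avg_def using emeasure_ball_pos_finite[OF assms, of x]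
  by (simp add: divide_less_ennreal)

lemma avg_ball_mono:
  assumes "\<And>y. y \<in> ball x r \<Longrightarrow> g y \<le> h y"
  shows "avg (ball x r) g \<le> avg (ball x r) h"
  unfolding avg_def
  by (intro divide_right_mono_ennreal nn_integral_mono) (auto simp: indicator_def assms)

lemma avg_ball_cong:
  assumes "\<And>y. y \<in> ball x r \<Longrightarrow> g y = h y"
  shows "avg (ball x r) g = avg (ball x r) h"
  using assms by (intro antisym avg_ball_mono) auto

lemma nn_set_integral_mono_set:
  assumes "A \<subseteq> B"
  shows "(\<integral>\<^sup>+y\<in>A. g y \<partial>M) \<le> (\<integral>\<^sup>+y\<in>B. (g y::ennreal) \<partial>M)"
  using assms by (intro nn_integral_mono) (auto simp: indicator_def)

lemma avg_mono_ball:
  assumes "ball y s \<subseteq> ball (x::'a::euclidean_space) (c * s)" "0 < s" "0 < c"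
  shows "avg (ball y s) g \<le> ennreal (c ^ DIM('a)) * avg (ball x (c * s)) g"
proof -
  have "(\<integral>\<^sup>+z\<in>ball y s. g z \<partial>lebesgue) \<le> (\<integral>\<^sup>+z\<in>ball x (c * s). g z \<partial>lebesgue)"
    by (rule nn_set_integral_mono_set[OF assms(1)])
  also have "\<dots> = avg (ball x (c * s)) g * emeasure lebesgue (ball x (c * s))"
    using assms by (intro avg_ball_times[symmetric]) auto
  also have "\<dots> = ennreal (c ^ DIM('a)) * avg (ball x (c * s)) g * emeasure lebesgue (ball y s)"
    using assms by (subst emeasure_ball_scale[of c s x y]) (auto simp: mult_ac)
  finally show ?thesis using assms by (simp add: avg_ball_le_iff)
qed

text \<open>A ball whose centre lies in \<open>B\<^sub>R\<close> may stick out of \<open>B\<^sub>R\<close>, but pulling its centre towards the origin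
by the factor \<open>1 - r / (2R)\<close> shows that at most the fraction \<open>1 - 2\<^sup>-\<^sup>d\<close> of it is lost. This makes up
for the boundary both when \<open>\<integral>\<phi>\<close> is compared with the integral of its unit averages over the same
ball and when stopping balls are compared with level sets, which live in \<open>B\<^sub>R\<^sub>/\<^sub>2\<close>.\<close>

lemma ball_halving:
  fixes x :: "'a::euclidean_space"
  assumes "x \<in> ball 0 R" "0 < r" "r \<le> R"
  obtains z where "ball z (r / 2) \<subseteq> ball x r \<inter> ball 0 R"
proof -
  define z where "z = (1 - r / (2 * R)) *\<^sub>R x"
  have R: "0 < R" using assms(2,3) by linarith
  have c: "0 \<le> 1 - r / (2 * R)" using assms(3) R by simp
  have nx: "norm x < R" using assms(1) by (simp add: dist_norm)
  have "norm z = (1 - r / (2 * R)) * norm x" using c by (simp add: z_def)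
  also have "\<dots> \<le> (1 - r / (2 * R)) * R" using c nx by (intro mult_left_mono) auto
  also have "\<dots> = R - r / 2" using R by (simp add: field_simps)
  finally have 1: "norm z + r / 2 \<le> R" by simp
  have "dist x z = r / (2 * R) * norm x"
  proof -
    have "x - z = (r / (2 * R)) *\<^sub>R x" by (simp add: z_def algebra_simps)
    then show ?thesis using assms(2) R by (simp add: dist_norm)
  qed
  also have "\<dots> \<le> r / (2 * R) * R" using assms(2) R nx by (intro mult_left_mono) auto
  also have "\<dots> = r / 2" using R by simp
  finally have 2: "dist x z \<le> r / 2" .
  have "ball z (r / 2) \<subseteq> ball x r \<inter> ball 0 R"
  proof
    fix w assume w: "w \<in> ball z (r / 2)"
    have "dist x w \<le> dist x z + dist z w" by (rule dist_triangle)
    moreover have "dist 0 w \<le> dist 0 z + dist z w" by (rule dist_triangle)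
    ultimately show "w \<in> ball x r \<inter> ball 0 R" using 1 2 w by auto
  qed
  then show thesis by (rule that)
qed

section \<open>The average over unit balls\<close>

definition unit_mean :: "('a::euclidean_space \<Rightarrow> ennreal) \<Rightarrow> 'a \<Rightarrow> ennreal" where
  "unit_mean \<phi> x = avg (ball x 1) \<phi>"

text \<open>Both facts are Tonelli's theorem for the kernel \<open>1\<^bsub>|x - y| < 1\<^esub>\<close>. The product measure
requires Borel functions, so \<open>\<phi>\<close> is first replaced by a Borel function that agrees with it almost
everywhere; this does not change any unit average.\<close>

lemma
  fixes \<phi> :: "'a::euclidean_space \<Rightarrow> ennreal"
  assumes "\<phi> \<in> borel_measurable lebesgue"
  shows unit_mean_measurable: "unit_mean \<phi> \<in> borel_measurable lborel"
    and integral_unit_mean: "B \<in> sets borel \<Longrightarrow> (\<integral>\<^sup>+x\<in>B. unit_mean \<phi> x \<partial>lebesgue)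
      = (\<integral>\<^sup>+z. \<phi> z * (emeasure lebesgue (ball z 1 \<inter> B) / emeasure lebesgue (ball (0::'a) 1)) \<partial>lebesgue)"
proof -
  obtain \<phi>' where m[measurable]: "\<phi>' \<in> borel_measurable lborel" and ae: "AE x in lborel. \<phi> x = \<phi>' x"
    using completion_ex_borel_measurable[OF assms] by auto
  have b: "emeasure lebesgue (ball x 1) = emeasure lebesgue (ball (0::'a) 1)" for x :: 'a
    by (simp add: emeasure_ball)
  define A where "A = {p :: 'a \<times> 'a. dist (fst p) (snd p) < 1}"
  have "open A" unfolding A_def by (intro open_Collect_less continuous_intros)
  then have [measurable]: "A \<in> sets (lborel \<Otimes>\<^sub>M lborel)"
    unfolding lborel_prod by (simp add: borel_open)
  have A_iff: "(x, y) \<in> A \<longleftrightarrow> dist x y < 1" for x y by (simp add: A_def)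
  let ?v = "emeasure lebesgue (ball (0::'a) 1)"
  have eq: "unit_mean \<phi> x = (\<integral>\<^sup>+y. \<phi>' y * indicator A (x, y) \<partial>lborel) / ?v" for x
  proof -
    have "(\<integral>\<^sup>+y. \<phi> y * indicator (ball x 1) y \<partial>lborel)
      = (\<integral>\<^sup>+y. \<phi>' y * indicator A (x, y) \<partial>lborel)"
      by (intro nn_integral_cong_AE) (use ae in \<open>auto simp: indicator_def A_iff\<close>)
    then show ?thesis
      unfolding unit_mean_def avg_def nn_integral_completion by (simp only: b[of x])
  qed
  have mm: "(\<lambda>x. \<integral>\<^sup>+y. \<phi>' y * indicator A (x, y) \<partial>lborel) \<in> borel_measurable lborel"
    by measurable
  show "unit_mean \<phi> \<in> borel_measurable lborel"
    unfolding eq[abs_def] using mm by measurable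
  assume [measurable]: "B \<in> sets borel"
  have "(\<integral>\<^sup>+x\<in>B. unit_mean \<phi> x \<partial>lebesgue)
    = (\<integral>\<^sup>+x. (\<integral>\<^sup>+y. \<phi>' y * indicator A (x, y) \<partial>lborel) * (indicator B x / ?v) \<partial>lborel)"
    unfolding eq nn_integral_completion
    by (intro nn_integral_cong) (simp add: ennreal_divide_times mult_ac divide_ennreal_def)
  also have "\<dots> = (\<integral>\<^sup>+x. (\<integral>\<^sup>+y. \<phi>' y * indicator A (x, y) * (indicator B x / ?v) \<partial>lborel) \<partial>lborel)"
    by (intro nn_integral_cong nn_integral_multc[symmetric]) measurable
  also have "\<dots> = (\<integral>\<^sup>+y. (\<integral>\<^sup>+x. \<phi>' y * indicator A (x, y) * (indicator B x / ?v) \<partial>lborel) \<partial>lborel)"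
    by (rule lborel_pair.Fubini') measurable
  also have "\<dots> = (\<integral>\<^sup>+y. \<phi>' y * (emeasure lebesgue (ball y 1 \<inter> B) / ?v) \<partial>lborel)"
  proof (intro nn_integral_cong)
    fix y :: 'a
    have "(\<integral>\<^sup>+x. \<phi>' y * indicator A (x, y) * (indicator B x / ?v) \<partial>lborel)
      = (\<integral>\<^sup>+x. \<phi>' y / ?v * indicator (ball y 1 \<inter> B) x \<partial>lborel)"
      by (intro nn_integral_cong)
        (auto simp: indicator_def A_iff dist_commute divide_ennreal_def mult_ac)
    also have "\<dots> = \<phi>' y / ?v * emeasure lborel (ball y 1 \<inter> B)"
      by (subst nn_integral_cmult_indicator) auto
    finally show "(\<integral>\<^sup>+x. \<phi>' y * indicator A (x, y) * (indicator B x / ?v) \<partial>lborel)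
      = \<phi>' y * (emeasure lebesgue (ball y 1 \<inter> B) / ?v)"
      by (simp add: divide_ennreal_def mult_ac)
  qed
  also have "\<dots> = (\<integral>\<^sup>+y. \<phi> y * (emeasure lebesgue (ball y 1 \<inter> B) / ?v) \<partial>lebesgue)"
    unfolding nn_integral_completion by (intro nn_integral_cong_AE) (use ae in auto)
  finally show "(\<integral>\<^sup>+x\<in>B. unit_mean \<phi> x \<partial>lebesgue) =
    (\<integral>\<^sup>+z. \<phi> z * (emeasure lebesgue (ball z 1 \<inter> B) / ?v) \<partial>lebesgue)" .
qed

text \<open>By Tonelli, the integral of the unit averages over \<open>B\<close> weights each \<open>\<phi>(z)\<close> with the proportion of
\<open>B\<^sub>1(z)\<close> inside \<open>B\<close>. As soon as this proportion is at least \<open>1 / c\<close> on \<open>A\<close>, the coarsened integral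
controls the original one.\<close>

lemma set_integral_le_unit_mean:
  fixes \<phi> :: "'a::euclidean_space \<Rightarrow> ennreal"
  assumes "\<phi> \<in> borel_measurable lebesgue" "B \<in> sets borel" "A \<in> sets borel" "0 \<le> c"
    and "\<And>z. z \<in> A \<Longrightarrow> emeasure lebesgue (ball (0::'a) 1) \<le> ennreal c * emeasure lebesgue (ball z 1 \<inter> B)"
  shows "(\<integral>\<^sup>+x\<in>A. \<phi> x \<partial>lebesgue) \<le> ennreal c * (\<integral>\<^sup>+x\<in>B. unit_mean \<phi> x \<partial>lebesgue)"
proof -
  let ?v = "emeasure lebesgue (ball (0::'a) 1)"
  have v: "?v \<noteq> 0" "?v < top" using emeasure_ball_pos_finite[of 1] by auto
  have 1: "1 \<le> ennreal c * (emeasure lebesgue (ball z 1 \<inter> B) / ?v)" if "z \<in> A" for z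
  proof -
    have "1 = ?v / ?v" using v by simp
    also have "\<dots> \<le> ennreal c * emeasure lebesgue (ball z 1 \<inter> B) / ?v"
      by (rule divide_right_mono_ennreal) (rule assms(5)[OF that])
    finally show ?thesis by (simp add: ennreal_times_divide)
  qed
  have m: "(\<lambda>z. emeasure lborel (ball z 1 \<inter> B)) \<in> borel_measurable lborel"
  proof -
    let ?A = "{p :: 'a \<times> 'a. dist (fst p) (snd p) < 1} \<inter> UNIV \<times> B"
    have "open {p :: 'a \<times> 'a. dist (fst p) (snd p) < 1}"
      by (intro open_Collect_less continuous_intros)
    then have "{p :: 'a \<times> 'a. dist (fst p) (snd p) < 1} \<in> sets (lborel \<Otimes>\<^sub>M lborel)"
      unfolding lborel_prod by (simp add: borel_open)
    then have A: "?A \<in> sets (lborel \<Otimes>\<^sub>M lborel)"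
      using assms(2) by (intro sets.Int pair_measureI) auto
    have "Pair z -` ?A = ball z 1 \<inter> B" for z
      by auto
    then show ?thesis
      using lborel.measurable_emeasure_Pair[OF A] by simp
  qed
  have m': "(\<lambda>z. emeasure lebesgue (ball z 1 \<inter> B)) \<in> borel_measurable lebesgue"
  proof -
    have "(\<lambda>z. emeasure lebesgue (ball z 1 \<inter> B)) = (\<lambda>z. emeasure lborel (ball z 1 \<inter> B))"
      using assms(2) by simp
    then show ?thesis using measurable_completion[OF m] by simp
  qed
  have "(\<integral>\<^sup>+x\<in>A. \<phi> x \<partial>lebesgue)
     \<le> (\<integral>\<^sup>+z. ennreal c * (\<phi> z * (emeasure lebesgue (ball z 1 \<inter> B) / ?v)) \<partial>lebesgue)"
  proof (intro nn_integral_mono)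
    fix z
    show "\<phi> z * indicator A z \<le> ennreal c * (\<phi> z * (emeasure lebesgue (ball z 1 \<inter> B) / ?v))"
      using mult_left_mono[OF 1, of z "\<phi> z"] by (cases "z \<in> A") (auto simp: mult_ac)
  qed
  also have "\<dots> = ennreal c * (\<integral>\<^sup>+x\<in>B. unit_mean \<phi> x \<partial>lebesgue)"
    using m' assms by (subst nn_integral_cmult) (auto simp: integral_unit_mean)
  finally show ?thesis .
qed

lemma ball_integral_le_unit_mean:
  fixes \<phi> :: "'a::euclidean_space \<Rightarrow> ennreal"
  assumes "\<phi> \<in> borel_measurable lebesgue"
  shows "(\<integral>\<^sup>+x\<in>ball y r. \<phi> x \<partial>lebesgue) \<le> (\<integral>\<^sup>+x\<in>ball y (r + 1). unit_mean \<phi> x \<partial>lebesgue)"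
proof -
  have "ball z 1 \<inter> ball y (r + 1) = ball z 1" if "z \<in> ball y r" for z
  proof -
    have "w \<in> ball y (r + 1)" if "w \<in> ball z 1" for w
      using that \<open>z \<in> ball y r\<close> dist_triangle[of y w z] by (simp)
    then show ?thesis by auto
  qed
  then have "(\<integral>\<^sup>+x\<in>ball y r. \<phi> x \<partial>lebesgue) \<le> ennreal 1 * (\<integral>\<^sup>+x\<in>ball y (r + 1). unit_mean \<phi> x \<partial>lebesgue)"
    by (intro set_integral_le_unit_mean assms) (auto simp: emeasure_ball)
  then show ?thesis by simp
qed

lemma ball_integral_le_unit_mean_same:
  fixes \<phi> :: "'a::euclidean_space \<Rightarrow> ennreal"
  assumes "\<phi> \<in> borel_measurable lebesgue" "1 \<le> R"
  shows "(\<integral>\<^sup>+x\<in>ball 0 R. \<phi> x \<partial>lebesgue)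
    \<le> ennreal (2 ^ DIM('a)) * (\<integral>\<^sup>+x\<in>ball 0 R. unit_mean \<phi> x \<partial>lebesgue)"
proof (intro set_integral_le_unit_mean assms)
  fix z :: 'a assume "z \<in> ball 0 R"
  then obtain w where w: "ball w (1/2) \<subseteq> ball z 1 \<inter> ball 0 R"
    using assms ball_halving[of z R 1] by auto
  have "emeasure lebesgue (ball (0::'a) 1) = ennreal (2 ^ DIM('a)) * emeasure lebesgue (ball w (1/2))"
    using emeasure_ball_scale[of 2 "1/2" "0::'a" w] by simp
  also have "\<dots> \<le> ennreal (2 ^ DIM('a)) * emeasure lebesgue (ball z 1 \<inter> ball 0 R)"
    using w by (intro mult_left_mono emeasure_mono) auto
  finally show "emeasure lebesgue (ball (0::'a) 1) \<le> ennreal (2 ^ DIM('a)) * emeasure lebesgue (ball z 1 \<inter> ball 0 R)" .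
qed auto

section \<open>The covering estimate\<close>

lemma emeasure_UN_le_countable:
  assumes "countable I" "\<And>i. i \<in> I \<Longrightarrow> X i \<in> sets M"
  shows "emeasure M (\<Union>(X ` I)) \<le> (\<integral>\<^sup>+i. emeasure M (X i) \<partial>count_space I)"
proof -
  have "emeasure M (\<Union>(X ` I)) = (\<integral>\<^sup>+x. indicator (\<Union>(X ` I)) x \<partial>M)"
    using assms by (intro nn_integral_indicator[symmetric]) (auto intro!: sets.countable_UN')
  also have "\<dots> \<le> (\<integral>\<^sup>+x. \<integral>\<^sup>+i. indicator (X i) x \<partial>count_space I \<partial>M)"
  proof (intro nn_integral_mono)
    fix x
    show "indicator (\<Union>(X ` I)) x \<le> (\<integral>\<^sup>+i. (indicator (X i) x :: ennreal) \<partial>count_space I)"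
    proof (cases "x \<in> \<Union>(X ` I)")
      case True
      then obtain i where i: "i \<in> I" "x \<in> X i" by auto
      have "(1::ennreal) = (\<integral>\<^sup>+j. indicator {i} j \<partial>count_space I)"
        using i by simp
      also have "\<dots> \<le> (\<integral>\<^sup>+i. indicator (X i) x \<partial>count_space I)"
        using i by (intro nn_integral_mono) (auto simp: indicator_def)
      finally show ?thesis using True by simp
    qed simp
  qed
  also have "\<dots> = (\<integral>\<^sup>+i. \<integral>\<^sup>+x. indicator (X i) x \<partial>M \<partial>count_space I)"
    using assms by (intro nn_integral_count_space_nn_integral) auto
  also have "\<dots> = (\<integral>\<^sup>+i. emeasure M (X i) \<partial>count_space I)"
    using assms by (intro nn_integral_cong) auto
  finally show ?thesis .
qed

text \<open>The weak type \<open>(1, 1)\<close> bound in covering form. The balls are selected by Vitali's covering lemma: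
the chosen ones are disjoint, so their masses add up to at most \<open>\<integral>\<^bsub>\<Omega>\<^esub> \<psi>\<close>, and their fivefold
enlargements cover \<open>S\<close>. The conclusion provides a measurable superset because
\<open>S\<close> is arbitrary and need not be measurable itself.\<close>

lemma covering_estimate:
  fixes \<psi> :: "'a::euclidean_space \<Rightarrow> ennreal"
  assumes \<psi>: "\<psi> \<in> borel_measurable lebesgue" and \<Omega>: "\<Omega> \<in> sets lebesgue"
    and S: "\<And>y. y \<in> S \<Longrightarrow> \<exists>\<rho>. 0 < \<rho> \<and> \<rho> \<le> D \<and> ball y \<rho> \<subseteq> \<Omega> \<and>
      c * emeasure lebesgue (ball y \<rho>) \<le> (\<integral>\<^sup>+z\<in>ball y \<rho>. \<psi> z \<partial>lebesgue)"
  obtains W where "W \<in> sets lebesgue" "S \<subseteq> W"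
    "c * emeasure lebesgue W \<le> ennreal (5 ^ DIM('a)) * (\<integral>\<^sup>+z\<in>\<Omega>. \<psi> z \<partial>lebesgue)"
proof -
  obtain \<rho> where \<rho>: "\<And>y. y \<in> S \<Longrightarrow> 0 < \<rho> y \<and> \<rho> y \<le> D" "\<And>y. y \<in> S \<Longrightarrow> ball y (\<rho> y) \<subseteq> \<Omega>"
    "\<And>y. y \<in> S \<Longrightarrow> c * emeasure lebesgue (ball y (\<rho> y)) \<le> (\<integral>\<^sup>+z\<in>ball y (\<rho> y). \<psi> z \<partial>lebesgue)"
    using S by metis
  obtain C where C: "countable C" "C \<subseteq> S"
    and disj: "pairwise (\<lambda>i j. disjnt (cball (id i) (\<rho> i)) (cball (id j) (\<rho> j))) C"
    and cov: "\<And>i. i \<in> S \<Longrightarrow> \<exists>j. j \<in> C \<and> \<not> disjnt (cball (id i) (\<rho> i)) (cball (id j) (\<rho> j)) \<and>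
                        cball (id i) (\<rho> i) \<subseteq> ball (id j) (5 * \<rho> j)"
    using Vitali_covering_lemma_cballs_balls[where a = id and r = \<rho> and K = S and B = D] \<rho>(1)
    by blast
  have dj: "disjoint_family_on (\<lambda>y. ball y (\<rho> y)) C"
    unfolding disjoint_family_on_def
  proof (intro ballI impI)
    fix x y assume "x \<in> C" "y \<in> C" "x \<noteq> y"
    then have "cball x (\<rho> x) \<inter> cball y (\<rho> y) = {}"
      using disj by (auto simp: pairwise_def disjnt_def)
    then show "ball x (\<rho> x) \<inter> ball y (\<rho> y) = {}"
      using ball_subset_cball by blast
  qed
  define W where "W = (\<Union>y\<in>C. ball y (5 * \<rho> y))"
  have "S \<subseteq> W"
  proof
    fix y assume y: "y \<in> S"
    from cov[OF y] obtain j where "j \<in> C" "cball y (\<rho> y) \<subseteq> ball j (5 * \<rho> j)" by auto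
    moreover have "y \<in> cball y (\<rho> y)" using \<rho>(1)[OF y] by auto
    ultimately show "y \<in> W" unfolding W_def by blast
  qed
  moreover have "W \<in> sets lebesgue" using C(1) unfolding W_def by (intro sets.countable_UN') auto
  moreover have "c * emeasure lebesgue W \<le> ennreal (5 ^ DIM('a)) * (\<integral>\<^sup>+z\<in>\<Omega>. \<psi> z \<partial>lebesgue)"
  proof -
    let ?N = "density lebesgue \<psi>"
    have "emeasure lebesgue W \<le> (\<integral>\<^sup>+y. emeasure lebesgue (ball y (5 * \<rho> y)) \<partial>count_space C)"
      unfolding W_def using C by (intro emeasure_UN_le_countable) auto
    also have "\<dots> = (\<integral>\<^sup>+y. ennreal (5 ^ DIM('a)) * emeasure lebesgue (ball y (\<rho> y)) \<partial>count_space C)"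
      using \<rho>(1) C by (intro nn_integral_cong emeasure_ball_scale) (auto intro: less_imp_le)
    also have "\<dots> = ennreal (5 ^ DIM('a)) * (\<integral>\<^sup>+y. emeasure lebesgue (ball y (\<rho> y)) \<partial>count_space C)"
      by (intro nn_integral_cmult) auto
    finally have "c * emeasure lebesgue W
      \<le> c * (ennreal (5 ^ DIM('a)) * (\<integral>\<^sup>+y. emeasure lebesgue (ball y (\<rho> y)) \<partial>count_space C))"
      by (intro mult_left_mono) auto
    also have "\<dots> = ennreal (5 ^ DIM('a)) * (\<integral>\<^sup>+y. c * emeasure lebesgue (ball y (\<rho> y)) \<partial>count_space C)"
      by (subst nn_integral_cmult) (auto simp: mult_ac)
    also have "\<dots> \<le> ennreal (5 ^ DIM('a)) * (\<integral>\<^sup>+y. emeasure ?N (ball y (\<rho> y)) \<partial>count_space C)"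
      using \<rho>(3) C \<psi> by (intro mult_left_mono nn_integral_mono) (auto simp: emeasure_density)
    also have "(\<integral>\<^sup>+y. emeasure ?N (ball y (\<rho> y)) \<partial>count_space C) = emeasure ?N (\<Union>y\<in>C. ball y (\<rho> y))"
      using C dj by (intro emeasure_UN_countable[symmetric]) auto
    also have "\<dots> \<le> emeasure ?N \<Omega>"
      using \<rho>(2) C \<Omega> by (intro emeasure_mono) auto
    also have "\<dots> = (\<integral>\<^sup>+z\<in>\<Omega>. \<psi> z \<partial>lebesgue)"
      using \<psi> \<Omega> by (simp add: emeasure_density)
    finally show ?thesis by (simp add: mult_left_mono)
  qed
  ultimately show ?thesis using that by blast
qed

section \<open>Powers and large averages\<close>

lemma epowr_pos: "0 < b \<Longrightarrow> epowr x b = (if x = \<infinity> then \<infinity> else ennreal (enn2real x powr b))"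
  by (simp add: epowr_def Let_def)

lemma epowr_ennreal: "0 < b \<Longrightarrow> 0 \<le> x \<Longrightarrow> epowr (ennreal x) b = ennreal (x powr b)"
  by (simp add: epowr_pos)

lemma epowr_measurable:
  assumes "0 < b" "g \<in> borel_measurable M"
  shows "(\<lambda>x. epowr (g x) b) \<in> borel_measurable M"
  using assms unfolding epowr_pos[OF assms(1)] by measurable

lemma epowr_one: "epowr x 1 = x"
  by (cases x) (auto simp: epowr_pos top_ereal_def)

text \<open>Chebyshev's trick: beyond the threshold \<open>a\<close> the factor \<open>(x / a)\<^bsup>b - 1\<^esup>\<close> is at least \<open>1\<close>. It takes
the place of Jensen's inequality in the next lemma, at the cost of a factor \<open>2\<close> in the
threshold.\<close>

lemma le_add_epowr:
  assumes "0 < a" "1 \<le> b"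
  shows "x \<le> ennreal a + ennreal (a powr (1 - b)) * epowr x b"
proof (cases x)
  case (real r)
  show ?thesis
  proof (cases "r \<le> a")
    case True
    then have "x \<le> ennreal a" using real by (simp add: ennreal_leI)
    then show ?thesis by (simp add: add_increasing2)
  next
    case False
    have "r = r powr (1 - b) * r powr b"
      using False assms by (simp add: powr_add[symmetric])
    also have "\<dots> \<le> a powr (1 - b) * r powr b"
      using False assms by (intro mult_right_mono powr_mono2') auto
    finally have "x \<le> ennreal (a powr (1 - b) * r powr b)" using real by (simp add: ennreal_leI)
    also have "\<dots> = ennreal (a powr (1 - b)) * epowr x b"
      using real assms by (simp add: epowr_ennreal ennreal_mult)
    finally show ?thesis by (simp add: add_increasing)
  qed
next
  case top
  then show ?thesis using assms by (simp add: epowr_pos ennreal_mult_eq_top_iff ennreal_eq_0_iff)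
qed

text \<open>A large average of \<open>g\<close> forces a large average of \<open>g\<^sup>b\<close>. In combination with the covering estimate
this gives weak type bounds of order \<open>b\<close> from integrability of \<open>g\<^sup>b\<close>.\<close>

lemma ball_integral_epowr_ge:
  fixes g :: "'a::euclidean_space \<Rightarrow> ennreal"
  assumes "g \<in> borel_measurable lebesgue" "0 < a" "1 \<le> b" "0 < r"
    and "ennreal (2 * a) * emeasure lebesgue (ball y r) \<le> (\<integral>\<^sup>+z\<in>ball y r. g z \<partial>lebesgue)"
  shows "ennreal (a powr b) * emeasure lebesgue (ball y r) \<le> (\<integral>\<^sup>+z\<in>ball y r. epowr (g z) b \<partial>lebesgue)"
proof -
  let ?I = "\<integral>\<^sup>+z\<in>ball y r. epowr (g z) b \<partial>lebesgue" and ?v = "emeasure lebesgue (ball y r)"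
  have m: "(\<lambda>z. epowr (g z) b) \<in> borel_measurable lebesgue"
    using assms by (intro epowr_measurable) auto
  have mb: "ball y r \<in> sets lebesgue" by simp
  have m2: "(\<lambda>z. epowr (g z) b * indicator (ball y r) z) \<in> borel_measurable lebesgue"
    by (intro borel_measurable_times_ennreal borel_measurable_indicator m mb)
  have two: "ennreal (2 * a) = ennreal a + ennreal a"
    using ennreal_plus[of a a] assms(2) by (simp only: mult_2)
  have "ennreal (2 * a) * ?v \<le> (\<integral>\<^sup>+z. ennreal a * indicator (ball y r) z
      + ennreal (a powr (1 - b)) * (epowr (g z) b * indicator (ball y r) z) \<partial>lebesgue)"
    by (rule order_trans[OF assms(5)], rule nn_integral_mono)
      (use le_add_epowr[OF assms(2,3)] in \<open>auto simp: indicator_def\<close>)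
  also have "\<dots> = ennreal a * ?v + ennreal (a powr (1 - b)) * ?I"
    using m mb m2
    by (subst nn_integral_add) (auto simp only: nn_integral_cmult nn_integral_cmult_indicator
        intro!: borel_measurable_times_ennreal borel_measurable_indicator borel_measurable_const)
  finally have *: "ennreal a * ?v + ennreal a * ?v \<le> ennreal a * ?v + ennreal (a powr (1 - b)) * ?I"
    unfolding two distrib_right .
  have "ennreal a * ?v \<noteq> top" using emeasure_ball_pos_finite(2)[OF assms(4), of y]
    by (auto simp: ennreal_mult_eq_top_iff)
  then have "ennreal a * ?v \<le> ennreal (a powr (1 - b)) * ?I"
    using * ennreal_add_left_cancel_le by (metis infinity_ennreal_def)
  then have "ennreal (a powr (b - 1)) * (ennreal a * ?v)
      \<le> ennreal (a powr (b - 1)) * (ennreal (a powr (1 - b)) * ?I)"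
    by (intro mult_left_mono) auto
  moreover have "ennreal (a powr (b - 1)) * ennreal a = ennreal (a powr b)"
    using assms(2) by (simp add: ennreal_mult[symmetric] powr_diff)
  moreover have "ennreal (a powr (b - 1)) * ennreal (a powr (1 - b)) = 1"
    using assms(2) by (simp add: ennreal_mult[symmetric] powr_add[symmetric])
  ultimately show ?thesis by (simp add: mult.assoc[symmetric])
qed

section \<open>Level sets under coarse comparison\<close>

lemma ennreal_mult_le_cancel:
  assumes "0 < c" "ennreal c * x \<le> y"
  shows "x \<le> ennreal (1 / c) * y"
proof -
  have "ennreal (1 / c) * (ennreal c * x) \<le> ennreal (1 / c) * y"
    using assms(2) by (rule mult_left_mono) simp
  moreover have "ennreal (1 / c) * ennreal c = 1"
    using assms(1) by (simp add: ennreal_mult[symmetric])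
  ultimately show ?thesis by (simp add: mult.assoc[symmetric])
qed

lemma ennreal_mult_assoc:
  "0 \<le> a \<Longrightarrow> 0 \<le> b \<Longrightarrow> ennreal a * (ennreal b * x) = ennreal (a * b) * x"
  by (simp add: ennreal_mult mult.assoc)

definition level_set :: "('a::euclidean_space \<Rightarrow> ennreal) \<Rightarrow> real \<Rightarrow> real \<Rightarrow> 'a set" where
  "level_set G R t = {x \<in> ball 0 (R / 2). \<exists>r>1. ennreal t < avg (ball x r) G}"

lemma level_set_mono: "s \<le> t \<Longrightarrow> level_set G R t \<subseteq> level_set G R s"
  unfolding level_set_def by (auto dest: ennreal_leI) (meson ennreal_leI le_less_trans)

text \<open>The proof uses the functions \<open>u\<close>, \<open>f\<close> and \<open>v\<close> only through \<open>G = |\<nabla>u|\<^sup>2\<close>, \<open>F = f\<^sup>2\<close>,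
\<open>V = |\<nabla>v|\<^sup>2\<close> and \<open>D = |\<nabla>u - \<nabla>v|\<^sup>2\<close>. The locale records the relations between these functions and
upper bounds \<open>ts\<close> and \<open>\<kappa>\<close> for the coarsened norms. Assumption \<open>approx\<close> is phrased with an
arbitrary \<open>\<delta>\<close> above the average of \<open>F\<close> because the infimum over the class of competitors need not
be attained.\<close>

locale coarse_comparison =
  fixes G F K :: "'a::euclidean_space \<Rightarrow> ennreal" and R p q ts \<kappa> :: real
  assumes G_meas: "G \<in> borel_measurable lebesgue"
    and F_meas: "F \<in> borel_measurable lebesgue"
    and K_meas: "K \<in> borel_measurable lebesgue"
    and R_ge: "10 \<le> R" and p_gt: "2 < p" and q_gt: "p < q"
    and ts_pos: "0 < ts" and \<kappa>_ge: "1 \<le> \<kappa>"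
    and G_supp: "\<And>x. x \<notin> ball 0 R \<Longrightarrow> G x = 0"
    and G_mean: "(\<integral>\<^sup>+x\<in>ball 0 R. unit_mean G x \<partial>lebesgue)
      \<le> ennreal ts * emeasure lebesgue (ball (0::'a) R)"
    and F_mean: "(\<integral>\<^sup>+x\<in>ball 0 R. epowr (unit_mean F x) (p / 2) \<partial>lebesgue)
      \<le> ennreal (ts powr (p / 2)) * emeasure lebesgue (ball (0::'a) R)"
    and K_mean: "(\<integral>\<^sup>+x\<in>ball 0 R. unit_mean (\<lambda>y. epowr (K y) (q / 2)) x \<partial>lebesgue)
      \<le> ennreal \<kappa> * emeasure lebesgue (ball (0::'a) R)"
    and approx: "\<And>r x \<delta>. 4 \<le> r \<Longrightarrow> r \<le> R / 2 \<Longrightarrow> x \<in> ball 0 (R / 2) \<Longrightarrow> avg (ball x r) F < \<delta> \<Longrightarrow>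
      \<exists>D V. D \<in> borel_measurable lebesgue \<and> V \<in> borel_measurable lebesgue \<and>
        (\<forall>y\<in>ball x (r / 2). G y \<le> 2 * D y + 2 * V y \<and> V y \<le> 2 * G y + 2 * D y) \<and>
        avg (ball x (r / 2)) D < \<delta> \<and>
        (\<forall>y\<in>ball x (r / 4). unit_mean V y \<le> K y * avg (ball x (r / 2)) V)"
begin


abbreviation vol :: "'a set \<Rightarrow> ennreal" where "vol \<equiv> emeasure lebesgue"

lemma avg_G_le:
  assumes "0 < r"
  shows "avg (ball x r) G \<le> ennreal ((2 * R / r) ^ DIM('a) * ts)"
proof -
  have "(\<integral>\<^sup>+y\<in>ball x r. G y \<partial>lebesgue) \<le> (\<integral>\<^sup>+y\<in>ball 0 R. G y \<partial>lebesgue)"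
    by (intro nn_integral_mono) (use G_supp in \<open>auto simp: indicator_def\<close>)
  also have "\<dots> \<le> ennreal (2 ^ DIM('a)) * (\<integral>\<^sup>+y\<in>ball 0 R. unit_mean G y \<partial>lebesgue)"
    using R_ge by (intro ball_integral_le_unit_mean_same G_meas) auto
  also have "\<dots> \<le> ennreal (2 ^ DIM('a)) * (ennreal ts * vol (ball 0 R))"
    by (intro mult_left_mono G_mean) auto
  also have "vol (ball 0 R) = vol (ball 0 (R / r * r))" using assms by simp
  also have "\<dots> = ennreal ((R / r) ^ DIM('a)) * vol (ball x r)"
    using assms R_ge by (intro emeasure_ball_scale) auto
  also have "ennreal (2 ^ DIM('a)) * (ennreal ts * (ennreal ((R / r) ^ DIM('a)) * vol (ball x r)))
    = ennreal (2 ^ DIM('a) * (ts * (R / r) ^ DIM('a))) * vol (ball x r)"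
    using assms R_ge ts_pos by (simp add: ennreal_mult mult.assoc)
  also have "2 ^ DIM('a) * (ts * (R / r) ^ DIM('a)) = (2 * R / r) ^ DIM('a) * ts"
    by (simp add: power_mult_distrib power_divide)
  finally show ?thesis using assms by (simp add: avg_ball_le_iff)
qed

text \<open>The averages of \<open>G\<close> around a point of the level set exceed \<open>t\<close> only at radii below \<open>R / 80\<close>,
because at larger radii they are bounded by the global average. A radius in the upper half of the
range of such radii is as good as a maximal one, which need not exist.\<close>

lemma stopping_radius:
  assumes t: "160 ^ DIM('a) * ts \<le> t" and x: "x \<in> level_set G R t"
  obtains r where "1 < r" "r < R / 80" "ennreal t < avg (ball x r) G"
    "\<And>\<rho>. 2 * r \<le> \<rho> \<Longrightarrow> avg (ball x \<rho>) G \<le> ennreal t"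
proof -
  define S where "S = {r. 1 < r \<and> ennreal t < avg (ball x r) G}"
  have small: "r < R / 80" if "r \<in> S" for r
  proof (rule ccontr)
    assume "\<not> r < R / 80"
    then have "2 * R / r \<le> 160" using that R_ge by (auto simp: S_def field_simps)
    then have "(2 * R / r) ^ DIM('a) * ts \<le> 160 ^ DIM('a) * ts"
      using that R_ge ts_pos by (intro mult_right_mono power_mono) (auto simp: S_def)
    then have "ennreal ((2 * R / r) ^ DIM('a) * ts) \<le> ennreal t" using t by (intro ennreal_leI) simp
    then show False using that avg_G_le[of r x] by (auto simp: S_def dest: order_trans)
  qed
  obtain r0 where r0: "r0 \<in> S" using x by (auto simp: level_set_def S_def)
  have bdd: "bdd_above S" using small by (intro bdd_aboveI[of _ "R / 80"]) (auto intro: less_imp_le)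
  have "1 < Sup S" using r0 cSup_upper[OF r0 bdd] by (auto simp: S_def)
  then have "Sup S / 2 < Sup S" by simp
  then obtain r where r: "r \<in> S" "Sup S / 2 < r"
    using less_cSup_iff[of S "Sup S / 2"] r0 bdd by auto
  show thesis
  proof
    show "1 < r" "r < R / 80" "ennreal t < avg (ball x r) G" using r small by (auto simp: S_def)
    fix \<rho> assume "2 * r \<le> \<rho>"
    then have "\<rho> \<notin> S" using r cSup_upper[OF _ bdd, of \<rho>] by auto
    then show "avg (ball x \<rho>) G \<le> ennreal t" using \<open>1 < r\<close> \<open>2 * r \<le> \<rho>\<close> by (auto simp: S_def)
  qed
qed

text \<open>The two exceptional sets of an iteration step: centres of balls on which the coarsened data, or the
constant \<open>K\<close> in the interior estimate, have a large average.\<close>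

definition F_large :: "real \<Rightarrow> 'a set" where
  "F_large a = {y \<in> ball 0 (R / 2). \<exists>\<rho>. 0 < \<rho> \<and> \<rho> \<le> R / 2 \<and>
     ennreal (2 * a) * vol (ball y \<rho>) \<le> (\<integral>\<^sup>+z\<in>ball y \<rho>. unit_mean F z \<partial>lebesgue)}"

definition K_large :: "real \<Rightarrow> 'a set" where
  "K_large a = {y \<in> ball 0 (R / 2). \<exists>\<rho>. 0 < \<rho> \<and> \<rho> \<le> R / 2 - 1 \<and>
     ennreal (2 * a) * vol (ball y \<rho>) \<le> (\<integral>\<^sup>+z\<in>ball y \<rho>. K z \<partial>lebesgue)}"

lemma ball_subset_centered:
  assumes "y \<in> ball (0::'a) s" "s + \<rho> \<le> S"
  shows "ball y \<rho> \<subseteq> ball 0 S"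
proof
  fix z assume "z \<in> ball y \<rho>"
  moreover have "dist 0 z \<le> dist 0 y + dist y z" by (rule dist_triangle)
  ultimately show "z \<in> ball 0 S" using assms by auto
qed

lemma F_large_measure:
  assumes "0 < a"
  obtains W where "W \<in> sets lebesgue" "F_large a \<subseteq> W"
    "ennreal (a powr (p / 2)) * vol W \<le> ennreal (5 ^ DIM('a) * ts powr (p / 2)) * vol (ball 0 R)"
proof -
  have um: "unit_mean F \<in> borel_measurable lebesgue"
    using unit_mean_measurable[OF F_meas] by (intro measurable_completion) auto
  obtain W where W: "W \<in> sets lebesgue" "F_large a \<subseteq> W" and
    le: "ennreal (a powr (p / 2)) * vol W
      \<le> ennreal (5 ^ DIM('a)) * (\<integral>\<^sup>+z\<in>ball 0 R. epowr (unit_mean F z) (p / 2) \<partial>lebesgue)"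
  proof (rule covering_estimate)
    show "(\<lambda>z. epowr (unit_mean F z) (p / 2)) \<in> borel_measurable lebesgue"
      using um p_gt by (intro epowr_measurable) auto
    show "ball 0 R \<in> sets lebesgue" by simp
    fix y assume "y \<in> F_large a"
    then obtain \<rho> where \<rho>: "y \<in> ball 0 (R / 2)" "0 < \<rho>" "\<rho> \<le> R / 2"
      "ennreal (2 * a) * vol (ball y \<rho>) \<le> (\<integral>\<^sup>+z\<in>ball y \<rho>. unit_mean F z \<partial>lebesgue)"
      by (auto simp: F_large_def)
    have "ennreal (a powr (p / 2)) * vol (ball y \<rho>)
        \<le> (\<integral>\<^sup>+z\<in>ball y \<rho>. epowr (unit_mean F z) (p / 2) \<partial>lebesgue)"
      using um assms p_gt \<rho> by (intro ball_integral_epowr_ge) auto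
    moreover have "ball y \<rho> \<subseteq> ball 0 R" using \<rho> by (intro ball_subset_centered[of y "R / 2"]) auto
    ultimately show "\<exists>\<rho>. 0 < \<rho> \<and> \<rho> \<le> R / 2 \<and> ball y \<rho> \<subseteq> ball 0 R \<and>
      ennreal (a powr (p / 2)) * vol (ball y \<rho>)
        \<le> (\<integral>\<^sup>+z\<in>ball y \<rho>. epowr (unit_mean F z) (p / 2) \<partial>lebesgue)"
      using \<rho> by blast
  qed
  note le
  also have "ennreal (5 ^ DIM('a)) * (\<integral>\<^sup>+z\<in>ball 0 R. epowr (unit_mean F z) (p / 2) \<partial>lebesgue)
      \<le> ennreal (5 ^ DIM('a)) * (ennreal (ts powr (p / 2)) * vol (ball 0 R))"
    by (intro mult_left_mono F_mean) auto
  also have "\<dots> = ennreal (5 ^ DIM('a) * ts powr (p / 2)) * vol (ball 0 R)"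
    by (simp add: ennreal_mult mult.assoc)
  finally show ?thesis using W that by blast
qed

lemma K_large_measure:
  assumes "0 < a"
  obtains W where "W \<in> sets lebesgue" "K_large a \<subseteq> W"
    "ennreal (a powr (q / 2)) * vol W \<le> ennreal (5 ^ DIM('a) * \<kappa>) * vol (ball 0 R)"
proof -
  have m: "(\<lambda>z. epowr (K z) (q / 2)) \<in> borel_measurable lebesgue"
    using K_meas p_gt q_gt by (intro epowr_measurable) auto
  obtain W where W: "W \<in> sets lebesgue" "K_large a \<subseteq> W" and
    le: "ennreal (a powr (q / 2)) * vol W
      \<le> ennreal (5 ^ DIM('a)) * (\<integral>\<^sup>+z\<in>ball 0 (R - 1). epowr (K z) (q / 2) \<partial>lebesgue)"
  proof (rule covering_estimate[OF m])
    show "ball 0 (R - 1) \<in> sets lebesgue" by simp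
    fix y assume "y \<in> K_large a"
    then obtain \<rho> where \<rho>: "y \<in> ball 0 (R / 2)" "0 < \<rho>" "\<rho> \<le> R / 2 - 1"
      "ennreal (2 * a) * vol (ball y \<rho>) \<le> (\<integral>\<^sup>+z\<in>ball y \<rho>. K z \<partial>lebesgue)"
      by (auto simp: K_large_def)
    have "ennreal (a powr (q / 2)) * vol (ball y \<rho>)
        \<le> (\<integral>\<^sup>+z\<in>ball y \<rho>. epowr (K z) (q / 2) \<partial>lebesgue)"
      using K_meas assms p_gt q_gt \<rho> by (intro ball_integral_epowr_ge) auto
    moreover have "ball y \<rho> \<subseteq> ball 0 (R - 1)" using \<rho> by (intro ball_subset_centered[of y "R / 2"]) auto
    ultimately show "\<exists>\<rho>. 0 < \<rho> \<and> \<rho> \<le> R / 2 - 1 \<and> ball y \<rho> \<subseteq> ball 0 (R - 1) \<and>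
      ennreal (a powr (q / 2)) * vol (ball y \<rho>)
        \<le> (\<integral>\<^sup>+z\<in>ball y \<rho>. epowr (K z) (q / 2) \<partial>lebesgue)"
      using \<rho> by blast
  qed
  note le
  also have "(\<integral>\<^sup>+z\<in>ball 0 (R - 1). epowr (K z) (q / 2) \<partial>lebesgue)
    \<le> (\<integral>\<^sup>+z\<in>ball 0 R. unit_mean (\<lambda>y. epowr (K y) (q / 2)) z \<partial>lebesgue)"
    using ball_integral_le_unit_mean[OF m, of 0 "R - 1"] by simp
  also have "\<dots> \<le> ennreal \<kappa> * vol (ball 0 R)"
    by (rule K_mean)
  also have "ennreal (5 ^ DIM('a)) * \<dots> = ennreal (5 ^ DIM('a) * \<kappa>) * vol (ball 0 R)"
    using \<kappa>_ge by (simp add: ennreal_mult mult.assoc)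
  finally show ?thesis using W that by (simp add: mult_left_mono)
qed

text \<open>Estimate inside one stopping ball in which \<open>F\<close> is small. Let \<open>y\<close> lie in the level set for \<open>T\<close>,
with a radius \<open>\<rho>\<close> whose average of \<open>G\<close> exceeds \<open>T\<close>. The stopping property forces \<open>\<rho> < 2r\<close>, so the
ball around \<open>y\<close> stays where the competitor is available, and there \<open>D\<close> or \<open>V\<close> has an average of at
least \<open>T / 4\<close>. If it is \<open>D\<close>, the covering estimate applies and gains the factor \<open>\<epsilon> / \<Lambda>\<close>. If it is \<open>V\<close>, its
unit averages are at most \<open>6 t K\<close>, so \<open>K\<close> has an average of at least \<open>2 \<Lambda>\<close> and \<open>y\<close> belongs to
the exceptional set for \<open>K\<close>.\<close>

lemma good_ball:
  assumes x: "x \<in> ball 0 (R / 2)" and r: "1 < r" "r < R / 80"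
    and stop: "\<And>\<rho>. 2 * r \<le> \<rho> \<Longrightarrow> avg (ball x \<rho>) G \<le> ennreal t"
    and F: "avg (ball x (32 * r)) F \<le> ennreal (\<epsilon> * t)"
    and t: "0 < t" and \<epsilon>: "0 < \<epsilon>" "\<epsilon> \<le> 1" and \<Lambda>: "1 \<le> \<Lambda>"
  defines "T \<equiv> 48 * 4 ^ DIM('a) * \<Lambda> * t"
  obtains W where "W \<in> sets lebesgue"
    "level_set G R T \<inter> cball x (5 * r) \<subseteq> W \<union> K_large \<Lambda>"
    "vol W \<le> ennreal (80 ^ DIM('a) * (\<epsilon> / \<Lambda>)) * vol (ball x r)"
proof -
  have T: "0 < T" using t \<Lambda> by (simp add: T_def)
  have "avg (ball x (32 * r)) F < ennreal (2 * \<epsilon> * t)"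
    using F by (rule le_less_trans) (use t \<epsilon> in \<open>simp add: ennreal_lessI\<close>)
  then obtain D V where D_meas: "D \<in> borel_measurable lebesgue" and V_meas: "V \<in> borel_measurable lebesgue"
    and GV: "\<And>y. y \<in> ball x (16 * r) \<Longrightarrow> G y \<le> 2 * D y + 2 * V y"
    and VG: "\<And>y. y \<in> ball x (16 * r) \<Longrightarrow> V y \<le> 2 * G y + 2 * D y"
    and D: "avg (ball x (16 * r)) D < ennreal (2 * \<epsilon> * t)"
    and VK: "\<And>y. y \<in> ball x (8 * r) \<Longrightarrow> unit_mean V y \<le> K y * avg (ball x (16 * r)) V"
    using approx[of "32 * r" x "ennreal (2 * \<epsilon> * t)"] r x by auto
  have meas2: "(\<lambda>z. c * (g z * indicator (ball y \<rho>) z)) \<in> borel_measurable lebesgue"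
    if "g \<in> borel_measurable lebesgue" for g :: "'a \<Rightarrow> ennreal" and y \<rho> c
    using that by (intro borel_measurable_times_ennreal borel_measurable_indicator) auto
  have split_int: "(\<integral>\<^sup>+z\<in>ball y \<rho>. f z \<partial>lebesgue)
      \<le> 2 * (\<integral>\<^sup>+z\<in>ball y \<rho>. g z \<partial>lebesgue) + 2 * (\<integral>\<^sup>+z\<in>ball y \<rho>. h z \<partial>lebesgue)"
    if "g \<in> borel_measurable lebesgue" "h \<in> borel_measurable lebesgue"
      "\<And>z. z \<in> ball y \<rho> \<Longrightarrow> f z \<le> 2 * g z + 2 * h z" for f g h :: "'a \<Rightarrow> ennreal" and y \<rho>
  proof -
    have "(\<integral>\<^sup>+z\<in>ball y \<rho>. f z \<partial>lebesgue)
      \<le> (\<integral>\<^sup>+z. 2 * (g z * indicator (ball y \<rho>) z) + 2 * (h z * indicator (ball y \<rho>) z) \<partial>lebesgue)"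
      by (intro nn_integral_mono) (use that(3) in \<open>auto simp: indicator_def\<close>)
    also have "\<dots> = 2 * (\<integral>\<^sup>+z\<in>ball y \<rho>. g z \<partial>lebesgue) + 2 * (\<integral>\<^sup>+z\<in>ball y \<rho>. h z \<partial>lebesgue)"
      using meas2[OF that(1)] meas2[OF that(2)] meas2[OF that(1), of 1] meas2[OF that(2), of 1]
      by (subst nn_integral_add) (auto simp: nn_integral_cmult)
    finally show ?thesis .
  qed
  have avg_V: "avg (ball x (16 * r)) V \<le> ennreal (6 * t)"
  proof -
    let ?b = "vol (ball x (16 * r))"
    have G: "(\<integral>\<^sup>+z\<in>ball x (16 * r). G z \<partial>lebesgue) \<le> ennreal t * ?b"
      using stop[of "16 * r"] r by (simp add: avg_ball_le_iff)
    have D': "(\<integral>\<^sup>+z\<in>ball x (16 * r). D z \<partial>lebesgue) \<le> ennreal (2 * \<epsilon> * t) * ?b"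
      using D r by (simp add: avg_ball_less_iff less_imp_le)
    have "(\<integral>\<^sup>+z\<in>ball x (16 * r). V z \<partial>lebesgue)
      \<le> 2 * (\<integral>\<^sup>+z\<in>ball x (16 * r). G z \<partial>lebesgue) + 2 * (\<integral>\<^sup>+z\<in>ball x (16 * r). D z \<partial>lebesgue)"
      using G_meas D_meas VG by (rule split_int)
    also have "\<dots> \<le> 2 * (ennreal t * ?b) + 2 * (ennreal (2 * \<epsilon> * t) * ?b)"
      by (intro add_mono mult_left_mono G D') auto
    also have "\<dots> = ennreal (2 * t + 4 * \<epsilon> * t) * ?b"
    proof -
      have "ennreal (2 * t + 4 * \<epsilon> * t) = ennreal (2 * t) + ennreal (2 * (2 * \<epsilon> * t))"
        using t \<epsilon> by (subst ennreal_plus[symmetric]) auto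
      also have "\<dots> = 2 * ennreal t + 2 * ennreal (2 * \<epsilon> * t)"
        using t \<epsilon> by (simp only: ennreal_mult ennreal_numeral zero_le_numeral zero_le_mult_iff less_imp_le simp_thms)
      finally show ?thesis by (simp only: distrib_right mult.assoc)
    qed
    also have "\<dots> \<le> ennreal (6 * t) * ?b"
      using mult_right_mono[OF \<epsilon>(2), of t] t by (intro mult_right_mono ennreal_leI) auto
    finally show ?thesis using r by (simp add: avg_ball_le_iff)
  qed
  define S where "S = {y \<in> cball x (5 * r). \<exists>\<rho>. 0 < \<rho> \<and> \<rho> \<le> 2 * r \<and>
    ennreal (T / 4) * vol (ball y \<rho>) \<le> (\<integral>\<^sup>+z\<in>ball y \<rho>. D z \<partial>lebesgue)}"
  obtain W where W: "W \<in> sets lebesgue" "S \<subseteq> W" and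
    le: "ennreal (T / 4) * vol W \<le> ennreal (5 ^ DIM('a)) * (\<integral>\<^sup>+z\<in>ball x (16 * r). D z \<partial>lebesgue)"
  proof (rule covering_estimate[OF D_meas, of "ball x (16 * r)" S "2 * r" "ennreal (T / 4)"])
    fix y assume "y \<in> S"
    then obtain \<rho> where \<rho>: "dist x y \<le> 5 * r" "0 < \<rho>" "\<rho> \<le> 2 * r"
      "ennreal (T / 4) * vol (ball y \<rho>) \<le> (\<integral>\<^sup>+z\<in>ball y \<rho>. D z \<partial>lebesgue)"
      by (auto simp: S_def)
    moreover have "ball y \<rho> \<subseteq> ball x (16 * r)"
    proof
      fix z assume "z \<in> ball y \<rho>"
      then show "z \<in> ball x (16 * r)" using dist_triangle[of x z y] \<rho>(1,3) r by simp
    qed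
    ultimately show "\<exists>\<rho>>0. \<rho> \<le> 2 * r \<and> ball y \<rho> \<subseteq> ball x (16 * r) \<and>
      ennreal (T / 4) * vol (ball y \<rho>) \<le> (\<integral>\<^sup>+z\<in>ball y \<rho>. D z \<partial>lebesgue)"
      by blast
  qed auto
  have vol_W: "vol W \<le> ennreal (80 ^ DIM('a) * (\<epsilon> / \<Lambda>)) * vol (ball x r)"
  proof -
    have "vol W \<le> ennreal (1 / (T / 4)) * (ennreal (5 ^ DIM('a)) * (\<integral>\<^sup>+z\<in>ball x (16 * r). D z \<partial>lebesgue))"
      using T le by (intro ennreal_mult_le_cancel) auto
    also have "\<dots> \<le> ennreal (1 / (T / 4)) * (ennreal (5 ^ DIM('a)) * (ennreal (2 * \<epsilon> * t) * vol (ball x (16 * r))))"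
      using D r by (intro mult_left_mono) (auto simp: avg_ball_less_iff less_imp_le)
    also have "vol (ball x (16 * r)) = ennreal (16 ^ DIM('a)) * vol (ball x r)"
      using r by (intro emeasure_ball_scale) auto
    also have "ennreal (1 / (T / 4)) * (ennreal (5 ^ DIM('a)) * (ennreal (2 * \<epsilon> * t) * (ennreal (16 ^ DIM('a)) * vol (ball x r))))
      = ennreal (1 / (T / 4) * 5 ^ DIM('a) * (2 * \<epsilon> * t) * 16 ^ DIM('a)) * vol (ball x r)"
      using T \<epsilon> t by ((subst ennreal_mult_assoc, simp, simp)+) (rule refl)
    also have "\<dots> \<le> ennreal (80 ^ DIM('a) * (\<epsilon> / \<Lambda>)) * vol (ball x r)"
    proof (intro mult_right_mono ennreal_leI)
      have "1 / (T / 4) * 5 ^ DIM('a) * (2 * \<epsilon> * t) * 16 ^ DIM('a)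
         = (80 ^ DIM('a) * (\<epsilon> / \<Lambda>)) * (8 / (48 * 4 ^ DIM('a)))"
        using t \<Lambda> by (simp add: T_def power_mult_distrib[symmetric] field_simps)
      also have "\<dots> \<le> (80 ^ DIM('a) * (\<epsilon> / \<Lambda>)) * 1"
      proof (rule mult_left_mono)
        have "(1::real) \<le> 4 ^ DIM('a)" by (rule one_le_power) simp
        then have "8 \<le> 48 * (4::real) ^ DIM('a)" by linarith
        then show "8 / (48 * 4 ^ DIM('a)) \<le> (1::real)" by simp
      qed (use \<epsilon> \<Lambda> in auto)
      finally show "1 / (T / 4) * 5 ^ DIM('a) * (2 * \<epsilon> * t) * 16 ^ DIM('a) \<le> 80 ^ DIM('a) * (\<epsilon> / \<Lambda>)"
        by simp
    qed auto
    finally show ?thesis .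
  qed
  have "y \<in> W \<union> K_large \<Lambda>" if y: "y \<in> level_set G R T" "y \<in> cball x (5 * r)" for y
  proof -
    obtain \<rho> where \<rho>: "1 < \<rho>" "ennreal T < avg (ball y \<rho>) G" and yR: "y \<in> ball 0 (R / 2)"
      using y(1) by (auto simp: level_set_def)
    have dxy: "dist x y \<le> 5 * r" using y(2) by simp
    have \<rho>r: "\<rho> < 2 * r"
    proof (rule ccontr)
      assume "\<not> \<rho> < 2 * r"
      then have le: "2 * r \<le> \<rho>" by simp
      have "ball y \<rho> \<subseteq> ball x (7 / 2 * \<rho>)"
      proof
        fix z assume "z \<in> ball y \<rho>"
        then show "z \<in> ball x (7 / 2 * \<rho>)" using dist_triangle[of x z y] dxy le by simp
      qed
      then have "avg (ball y \<rho>) G \<le> ennreal ((7 / 2) ^ DIM('a)) * avg (ball x (7 / 2 * \<rho>)) G"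
        using \<rho> by (intro avg_mono_ball) auto
      also have "\<dots> \<le> ennreal ((7 / 2) ^ DIM('a)) * ennreal t"
        using le \<rho> by (intro mult_left_mono stop) auto
      also have "\<dots> = ennreal ((7 / 2) ^ DIM('a) * t)" using t by (simp add: ennreal_mult)
      also have "\<dots> \<le> ennreal T"
      proof (rule ennreal_leI)
        have "(7 / 2) ^ DIM('a) \<le> (4::real) ^ DIM('a)" by (rule power_mono) auto
        also have "\<dots> \<le> (48 * \<Lambda>) * 4 ^ DIM('a)"
          using \<Lambda> by (simp add: mult_ge1_I)
        finally show "(7 / 2) ^ DIM('a) * t \<le> T"
          using t unfolding T_def by (simp add: mult_ac)
      qed
      finally show False using \<rho>(2) by simp
    qed
    show ?thesis
    proof (cases "ennreal (T / 4) * vol (ball y \<rho>) \<le> (\<integral>\<^sup>+z\<in>ball y \<rho>. D z \<partial>lebesgue)")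
      case True
      then have "y \<in> S" using \<rho> \<rho>r y(2) by (auto simp: S_def intro!: exI[of _ \<rho>])
      then show ?thesis using W by auto
    next
      case False
      have sub: "ball y \<rho> \<subseteq> ball x (16 * r)"
      proof
        fix z assume "z \<in> ball y \<rho>"
        then show "z \<in> ball x (16 * r)" using dist_triangle[of x z y] dxy \<rho>r r by simp
      qed
      have V_large: "ennreal (T / 4) * vol (ball y \<rho>) \<le> (\<integral>\<^sup>+z\<in>ball y \<rho>. V z \<partial>lebesgue)"
      proof (rule ccontr)
        assume neg: "\<not> ?thesis"
        have "(\<integral>\<^sup>+z\<in>ball y \<rho>. G z \<partial>lebesgue)
          \<le> 2 * (\<integral>\<^sup>+z\<in>ball y \<rho>. D z \<partial>lebesgue) + 2 * (\<integral>\<^sup>+z\<in>ball y \<rho>. V z \<partial>lebesgue)"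
          using D_meas V_meas GV sub by (intro split_int) auto
        also have "\<dots> \<le> 2 * (ennreal (T / 4) * vol (ball y \<rho>)) + 2 * (ennreal (T / 4) * vol (ball y \<rho>))"
          using False neg by (intro add_mono mult_left_mono) auto
        also have "\<dots> = ennreal T * vol (ball y \<rho>)"
        proof -
          have "ennreal T = ennreal (4 * (T / 4))" by simp
          also have "\<dots> = 4 * ennreal (T / 4)" using T by (subst ennreal_mult) auto
          also have "4 * ennreal (T / 4) = 2 * ennreal (T / 4) + 2 * ennreal (T / 4)"
            unfolding distrib_right[symmetric] by simp
          finally show ?thesis by (simp only: distrib_right mult.assoc)
        qed
        finally have "avg (ball y \<rho>) G \<le> ennreal T" using \<rho> by (simp add: avg_ball_le_iff)
        then show False using \<rho>(2) by simp
      qed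
      let ?J = "\<integral>\<^sup>+z\<in>ball y (\<rho> + 1). K z \<partial>lebesgue"
      have "(\<integral>\<^sup>+z\<in>ball y \<rho>. V z \<partial>lebesgue) \<le> (\<integral>\<^sup>+z\<in>ball y (\<rho> + 1). unit_mean V z \<partial>lebesgue)"
        using V_meas by (rule ball_integral_le_unit_mean)
      also have "\<dots> \<le> (\<integral>\<^sup>+z. ennreal (6 * t) * (K z * indicator (ball y (\<rho> + 1)) z) \<partial>lebesgue)"
      proof (intro nn_integral_mono)
        fix z
        show "unit_mean V z * indicator (ball y (\<rho> + 1)) z
            \<le> ennreal (6 * t) * (K z * indicator (ball y (\<rho> + 1)) z)"
        proof (cases "z \<in> ball y (\<rho> + 1)")
          case True
          then have "z \<in> ball x (8 * r)" using dist_triangle[of x z y] dxy \<rho>r r by simp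
          then have "unit_mean V z \<le> K z * avg (ball x (16 * r)) V" by (rule VK)
          also have "\<dots> \<le> K z * ennreal (6 * t)" by (intro mult_left_mono avg_V) auto
          finally show ?thesis using True by (simp add: mult_ac)
        qed simp
      qed
      also have "\<dots> = ennreal (6 * t) * ?J"
        using meas2[OF K_meas, of 1] by (subst nn_integral_cmult) auto
      finally have "ennreal (T / 4) * vol (ball y \<rho>) \<le> ennreal (6 * t) * ?J"
        using V_large by (rule order_trans[rotated])
      then have "ennreal (1 / (6 * t)) * (ennreal (T / 4) * vol (ball y \<rho>)) \<le> ennreal (1 / (6 * t)) * (ennreal (6 * t) * ?J)"
        by (rule mult_left_mono) simp
      also have "ennreal (1 / (6 * t)) * (ennreal (6 * t) * ?J) = ?J"
        using t by (simp add: mult.assoc[symmetric] ennreal_mult[symmetric])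
      also have "ennreal (1 / (6 * t)) * (ennreal (T / 4) * vol (ball y \<rho>)) = ennreal (1 / (6 * t) * (T / 4)) * vol (ball y \<rho>)"
        using t T by (intro ennreal_mult_assoc) auto
      also have "1 / (6 * t) * (T / 4) = (2 * \<Lambda>) * (4 ^ DIM('a))"
        using t by (simp add: T_def field_simps)
      also have "ennreal ((2 * \<Lambda>) * (4 ^ DIM('a))) * vol (ball y \<rho>)
          = ennreal (2 * \<Lambda>) * (ennreal (4 ^ DIM('a)) * vol (ball y \<rho>))"
        using \<Lambda> by (intro ennreal_mult_assoc[symmetric]) auto
      also have "ennreal (4 ^ DIM('a)) * vol (ball y \<rho>) = vol (ball y (4 * \<rho>))"
        using \<rho> by (intro emeasure_ball_scale[symmetric]) auto
      finally have "ennreal (2 * \<Lambda>) * vol (ball y (4 * \<rho>)) \<le> ?J" .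
      moreover have "ennreal (2 * \<Lambda>) * vol (ball y (\<rho> + 1)) \<le> ennreal (2 * \<Lambda>) * vol (ball y (4 * \<rho>))"
        using \<rho> by (intro mult_left_mono emeasure_mono) auto
      ultimately have "ennreal (2 * \<Lambda>) * vol (ball y (\<rho> + 1)) \<le> ?J" by (rule order_trans[rotated])
      then have "y \<in> K_large \<Lambda>"
        using yR \<rho> \<rho>r r R_ge by (auto simp: K_large_def intro!: exI[of _ "\<rho> + 1"])
      then show ?thesis by simp
    qed
  qed
  then have "level_set G R T \<inter> cball x (5 * r) \<subseteq> W \<union> K_large \<Lambda>" by blast
  with W(1) show thesis using vol_W by (rule that)
qed

text \<open>One step of the iteration, from level \<open>t\<close> up to level \<open>T\<close> of order \<open>\<Lambda> t\<close>. Vitali's lemma selects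
disjoint stopping balls whose enlargements cover the level set for \<open>t\<close>, hence also the one for \<open>T\<close>.
If \<open>F\<close> has average above \<open>\<epsilon> t\<close> on the 32-fold multiple of a selected ball, then all points of
\<open>B\<^sub>R\<^sub>/\<^sub>2\<close> in the fivefold enlargement belong to the exceptional set for \<open>F\<close>; the other
balls fall under the previous lemma. The exceptional sets are estimated
globally, so only the contributions of \<open>D\<close> have to be summed over balls, and these
are absorbed by disjointness: a fixed fraction of each stopping ball lies in \<open>B\<^sub>R\<^sub>/\<^sub>2\<close> and thus
in the level set for \<open>t / 2\<^sup>d\<close>.\<close>

lemma level_set_step:
  assumes t: "160 ^ DIM('a) * ts \<le> t" and \<epsilon>: "0 < \<epsilon>" "\<epsilon> \<le> 1" and \<Lambda>: "1 \<le> \<Lambda>"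
    and W0: "W0 \<in> sets lebesgue" "level_set G R (t / 2 ^ DIM('a)) \<subseteq> W0"
  obtains W where "W \<in> sets lebesgue" "level_set G R (48 * 4 ^ DIM('a) * \<Lambda> * t) \<subseteq> W"
    "vol W \<le> ennreal (10 ^ DIM('a) * \<kappa> * \<Lambda> powr (- (q / 2))) * vol (ball 0 (R / 2))
      + ennreal (10 ^ DIM('a) * (2 * 2 ^ DIM('a) * ts / (\<epsilon> * t)) powr (p / 2)) * vol (ball 0 (R / 2))
      + ennreal (160 ^ DIM('a) * (\<epsilon> / \<Lambda>)) * vol W0"
proof -
  have t0: "0 < t" using t ts_pos by (smt (verit) zero_less_power mult_pos_pos)
  define T where "T = 48 * 4 ^ DIM('a) * \<Lambda> * t"
  have volR: "vol (ball 0 R) = ennreal (2 ^ DIM('a)) * vol (ball 0 (R / 2))"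
    using emeasure_ball_scale[of 2 "R / 2" 0 0] R_ge by simp
  have "\<forall>x\<in>level_set G R t. \<exists>r. 1 < r \<and> r < R / 80 \<and> ennreal t < avg (ball x r) G \<and>
      (\<forall>s. 2 * r \<le> s \<longrightarrow> avg (ball x s) G \<le> ennreal t)"
    using stopping_radius[OF t] by blast
  then obtain \<rho> where \<rho>: "\<And>x. x \<in> level_set G R t \<Longrightarrow> 1 < \<rho> x"
      "\<And>x. x \<in> level_set G R t \<Longrightarrow> \<rho> x < R / 80"
      "\<And>x. x \<in> level_set G R t \<Longrightarrow> ennreal t < avg (ball x (\<rho> x)) G"
      "\<And>x s. x \<in> level_set G R t \<Longrightarrow> 2 * \<rho> x \<le> s \<Longrightarrow> avg (ball x s) G \<le> ennreal t"
    by (metis (no_types))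
  have "0 < \<rho> x \<and> \<rho> x \<le> R / 80" if "x \<in> level_set G R t" for x
    using \<rho>(1,2)[OF that] by simp
  then obtain C where C: "countable C" "C \<subseteq> level_set G R t"
    and disj: "pairwise (\<lambda>i j. disjnt (cball (id i) (\<rho> i)) (cball (id j) (\<rho> j))) C"
    and cov: "\<And>i. i \<in> level_set G R t \<Longrightarrow> \<exists>j. j \<in> C \<and>
      \<not> disjnt (cball (id i) (\<rho> i)) (cball (id j) (\<rho> j)) \<and> cball (id i) (\<rho> i) \<subseteq> ball (id j) (5 * \<rho> j)"
    using Vitali_covering_lemma_cballs_balls[where a = id and r = \<rho> and K = "level_set G R t"] by blast
  define Good where "Good = {x \<in> C. avg (ball x (32 * \<rho> x)) F \<le> ennreal (\<epsilon> * t)}"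
  have Good_C: "Good \<subseteq> C" by (auto simp: Good_def)
  have CR: "x \<in> ball 0 (R / 2)" if "x \<in> C" for x
    using that C(2) unfolding level_set_def by blast
  have "\<exists>W. W \<in> sets lebesgue \<and> level_set G R T \<inter> cball x (5 * \<rho> x) \<subseteq> W \<union> K_large \<Lambda> \<and>
      vol W \<le> ennreal (80 ^ DIM('a) * (\<epsilon> / \<Lambda>)) * vol (ball x (\<rho> x))" if x: "x \<in> Good" for x
  proof -
    have xC: "x \<in> C" and xE: "x \<in> level_set G R t" and F: "avg (ball x (32 * \<rho> x)) F \<le> ennreal (\<epsilon> * t)"
      using x C(2) by (auto simp: Good_def)
    show ?thesis unfolding T_def
      by (rule good_ball[OF CR[OF xC] \<rho>(1)[OF xE] \<rho>(2)[OF xE] \<rho>(4)[OF xE] F t0 \<epsilon> \<Lambda>]) blast+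
  qed
  then obtain Wf where Wf: "\<And>x. x \<in> Good \<Longrightarrow> Wf x \<in> sets lebesgue"
    "\<And>x. x \<in> Good \<Longrightarrow> level_set G R T \<inter> cball x (5 * \<rho> x) \<subseteq> Wf x \<union> K_large \<Lambda>"
    "\<And>x. x \<in> Good \<Longrightarrow> vol (Wf x) \<le> ennreal (80 ^ DIM('a) * (\<epsilon> / \<Lambda>)) * vol (ball x (\<rho> x))"
    by metis
  \<comment> \<open>The factor \<open>2\<^sup>d\<close> pays for moving a ball of radius \<open>32 r\<close> to a centre at distance \<open>5 r\<close>, together
    with the unit by which coarsening enlarges the ball.\<close>
  define a where "a = \<epsilon> * t / (2 * 2 ^ DIM('a))"
  have a: "0 < a" using \<epsilon> t0 by (simp add: a_def)
  obtain WF where WF: "WF \<in> sets lebesgue" "F_large a \<subseteq> WF"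
    "ennreal (a powr (p / 2)) * vol WF \<le> ennreal (5 ^ DIM('a) * ts powr (p / 2)) * vol (ball 0 R)"
    using F_large_measure[OF a] by blast
  obtain WK where WK: "WK \<in> sets lebesgue" "K_large \<Lambda> \<subseteq> WK"
    "ennreal (\<Lambda> powr (q / 2)) * vol WK \<le> ennreal (5 ^ DIM('a) * \<kappa>) * vol (ball 0 R)"
    using K_large_measure[of \<Lambda>] \<Lambda> by auto
  define WG where "WG = (\<Union>x\<in>Good. Wf x)"
  have Good_countable: "countable Good" using C(1) Good_C by (rule countable_subset[rotated])
  have WG: "WG \<in> sets lebesgue"
    unfolding WG_def using Good_countable Wf(1) by (intro sets.countable_UN') auto
  have vol_WG: "vol WG \<le> ennreal (160 ^ DIM('a) * (\<epsilon> / \<Lambda>)) * vol W0"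
  proof -
    have disjB: "disjoint_family_on (\<lambda>x. ball x (\<rho> x) \<inter> ball 0 (R / 2)) Good"
      unfolding disjoint_family_on_def
    proof (intro ballI impI)
      fix x y assume "x \<in> Good" "y \<in> Good" "x \<noteq> y"
      then have "cball x (\<rho> x) \<inter> cball y (\<rho> y) = {}"
        using disj Good_C by (auto simp: pairwise_def disjnt_def)
      then show "ball x (\<rho> x) \<inter> ball 0 (R / 2) \<inter> (ball y (\<rho> y) \<inter> ball 0 (R / 2)) = {}"
        using ball_subset_cball by blast
    qed
    have half: "vol (ball x (\<rho> x)) \<le> ennreal (2 ^ DIM('a)) * vol (ball x (\<rho> x) \<inter> ball 0 (R / 2))"
      if "x \<in> Good" for x
    proof -
      have xE: "x \<in> level_set G R t" using that Good_C C(2) by auto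
      have xR: "x \<in> ball 0 (R / 2)" using that Good_C CR by blast
      have "0 < \<rho> x" "\<rho> x \<le> R / 2" using \<rho>(1,2)[OF xE] by linarith+
      from ball_halving[OF xR this] obtain z
        where z: "ball z (\<rho> x / 2) \<subseteq> ball x (\<rho> x) \<inter> ball 0 (R / 2)" by blast
      have "vol (ball x (\<rho> x)) = ennreal (2 ^ DIM('a)) * vol (ball z (\<rho> x / 2))"
        using emeasure_ball_scale[of 2 "\<rho> x / 2" x z] \<rho>(1)[OF xE] by simp
      also have "\<dots> \<le> ennreal (2 ^ DIM('a)) * vol (ball x (\<rho> x) \<inter> ball 0 (R / 2))"
        using z by (intro mult_left_mono emeasure_mono) auto
      finally show ?thesis .
    qed
    have sub: "ball x (\<rho> x) \<inter> ball 0 (R / 2) \<subseteq> W0" if "x \<in> Good" for x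
    proof
      fix y assume y: "y \<in> ball x (\<rho> x) \<inter> ball 0 (R / 2)"
      have xE: "x \<in> level_set G R t" using that Good_C C(2) by auto
      have "ball x (\<rho> x) \<subseteq> ball y (2 * \<rho> x)"
      proof
        fix z assume "z \<in> ball x (\<rho> x)"
        then show "z \<in> ball y (2 * \<rho> x)" using dist_triangle[of y z x] y by (simp add: dist_commute)
      qed
      then have "avg (ball x (\<rho> x)) G \<le> ennreal (2 ^ DIM('a)) * avg (ball y (2 * \<rho> x)) G"
        using \<rho>(1)[OF xE] by (intro avg_mono_ball) auto
      with \<rho>(3)[OF xE] have *: "ennreal t < ennreal (2 ^ DIM('a)) * avg (ball y (2 * \<rho> x)) G"
        by (rule less_le_trans)
      have "ennreal (t / 2 ^ DIM('a)) < avg (ball y (2 * \<rho> x)) G"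
      proof (rule ccontr)
        assume "\<not> ?thesis"
        then have "ennreal (2 ^ DIM('a)) * avg (ball y (2 * \<rho> x)) G
            \<le> ennreal (2 ^ DIM('a)) * ennreal (t / 2 ^ DIM('a))"
          by (intro mult_left_mono) auto
        also have "\<dots> = ennreal t" using t0 by (simp add: ennreal_mult[symmetric])
        finally show False using * by simp
      qed
      then have "y \<in> level_set G R (t / 2 ^ DIM('a))"
        using y \<rho>(1)[OF xE] by (auto simp: level_set_def intro!: exI[of _ "2 * \<rho> x"])
      then show "y \<in> W0" using W0(2) by auto
    qed
    let ?c = "ennreal (80 ^ DIM('a) * (\<epsilon> / \<Lambda>))"
    have "vol WG \<le> (\<integral>\<^sup>+x. vol (Wf x) \<partial>count_space Good)"
      unfolding WG_def using Good_countable Wf(1) by (rule emeasure_UN_le_countable)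
    also have "\<dots> \<le> (\<integral>\<^sup>+x. ?c * (ennreal (2 ^ DIM('a)) * vol (ball x (\<rho> x) \<inter> ball 0 (R / 2))) \<partial>count_space Good)"
      using Wf(3) half by (intro nn_integral_mono) (auto intro!: order_trans[OF Wf(3)] mult_left_mono half)
    also have "\<dots> = ?c * (ennreal (2 ^ DIM('a)) * (\<integral>\<^sup>+x. vol (ball x (\<rho> x) \<inter> ball 0 (R / 2)) \<partial>count_space Good))"
      by (simp add: nn_integral_cmult)
    also have "(\<integral>\<^sup>+x. vol (ball x (\<rho> x) \<inter> ball 0 (R / 2)) \<partial>count_space Good)
        = vol (\<Union>x\<in>Good. ball x (\<rho> x) \<inter> ball 0 (R / 2))"
      using Good_countable disjB by (intro emeasure_UN_countable[symmetric]) auto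
    also have "?c * (ennreal (2 ^ DIM('a)) * vol (\<Union>x\<in>Good. ball x (\<rho> x) \<inter> ball 0 (R / 2)))
        \<le> ?c * (ennreal (2 ^ DIM('a)) * vol W0)"
      using sub W0(1) by (intro mult_left_mono emeasure_mono) auto
    also have "\<dots> = ennreal (80 ^ DIM('a) * (\<epsilon> / \<Lambda>) * 2 ^ DIM('a)) * vol W0"
      using \<epsilon> \<Lambda> by (intro ennreal_mult_assoc) auto
    also have "80 ^ DIM('a) * (\<epsilon> / \<Lambda>) * 2 ^ DIM('a) = (80 * 2) ^ DIM('a) * (\<epsilon> / \<Lambda>)"
      unfolding power_mult_distrib by (simp only: mult_ac)
    finally show ?thesis by simp
  qed
  have vol_WK: "vol WK \<le> ennreal (10 ^ DIM('a) * \<kappa> * \<Lambda> powr (- (q / 2))) * vol (ball 0 (R / 2))"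
  proof -
    have "vol WK \<le> ennreal (1 / \<Lambda> powr (q / 2)) * (ennreal (5 ^ DIM('a) * \<kappa>) * vol (ball 0 R))"
      using \<Lambda> WK(3) by (intro ennreal_mult_le_cancel) auto
    also have "\<dots> = ennreal (1 / \<Lambda> powr (q / 2) * (5 ^ DIM('a) * \<kappa>) * 2 ^ DIM('a)) * vol (ball 0 (R / 2))"
      unfolding volR using \<Lambda> \<kappa>_ge by ((subst ennreal_mult_assoc, simp, simp)+) (rule refl)
    also have "1 / \<Lambda> powr (q / 2) * (5 ^ DIM('a) * \<kappa>) * 2 ^ DIM('a)
        = (5 * 2) ^ DIM('a) * \<kappa> * \<Lambda> powr (- (q / 2))"
      unfolding power_mult_distrib powr_minus_divide by (simp add: mult_ac)
    finally show ?thesis by simp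
  qed
  have vol_WF: "vol WF \<le> ennreal (10 ^ DIM('a) * (2 * 2 ^ DIM('a) * ts / (\<epsilon> * t)) powr (p / 2)) * vol (ball 0 (R / 2))"
  proof -
    have "vol WF \<le> ennreal (1 / a powr (p / 2)) * (ennreal (5 ^ DIM('a) * ts powr (p / 2)) * vol (ball 0 R))"
      using a WF(3) by (intro ennreal_mult_le_cancel) auto
    also have "\<dots> = ennreal (1 / a powr (p / 2) * (5 ^ DIM('a) * ts powr (p / 2)) * 2 ^ DIM('a)) * vol (ball 0 (R / 2))"
      unfolding volR using a ts_pos by ((subst ennreal_mult_assoc, simp, simp)+) (rule refl)
    also have "1 / a powr (p / 2) * (5 ^ DIM('a) * ts powr (p / 2)) * 2 ^ DIM('a)
        = (5 * 2) ^ DIM('a) * (ts / a) powr (p / 2)"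
      unfolding power_mult_distrib using ts_pos a by (simp add: powr_divide mult_ac)
    also have "ts / a = 2 * 2 ^ DIM('a) * ts / (\<epsilon> * t)"
      using t0 \<epsilon> by (simp add: a_def)
    finally show ?thesis by simp
  qed
  have "level_set G R T \<subseteq> WK \<union> WF \<union> WG"
  proof
    fix y assume y: "y \<in> level_set G R T"
    have yR: "y \<in> ball 0 (R / 2)" using y unfolding level_set_def by blast
    have "t \<le> T"
    proof -
      have "(1::real) \<le> 4 ^ DIM('a)" by (rule one_le_power) simp
      then have "1 \<le> 48 * (4::real) ^ DIM('a)" by linarith
      then have "1 * 1 \<le> 48 * 4 ^ DIM('a) * \<Lambda>" using \<Lambda> by (intro mult_mono) auto
      then show ?thesis using t0 unfolding T_def by simp
    qed
    then have yE: "y \<in> level_set G R t" using y level_set_mono by blast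
    obtain j where j: "j \<in> C" "cball y (\<rho> y) \<subseteq> ball j (5 * \<rho> j)" using cov[OF yE] by auto
    have jE: "j \<in> level_set G R t" using j C(2) by auto
    have "y \<in> cball y (\<rho> y)" using \<rho>(1)[OF yE] by simp
    then have yj: "y \<in> ball j (5 * \<rho> j)" using j(2) by blast
    show "y \<in> WK \<union> WF \<union> WG"
    proof (cases "j \<in> Good")
      case True
      have "y \<in> cball j (5 * \<rho> j)" using yj by simp
      then have "y \<in> Wf j \<union> K_large \<Lambda>" using Wf(2)[OF True] y by blast
      then show ?thesis using WK(2) True unfolding WG_def by blast
    next
      case False
      let ?r = "\<rho> j"
      have r: "1 < ?r" "?r < R / 80" using \<rho>[OF jE] by auto
      have large: "ennreal (\<epsilon> * t) * vol (ball j (32 * ?r)) \<le> (\<integral>\<^sup>+z\<in>ball j (32 * ?r). F z \<partial>lebesgue)"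
        using False j(1) r by (simp add: Good_def avg_ball_le_iff less_imp_le)
      have sub: "ball j (32 * ?r) \<subseteq> ball y (37 * ?r)"
      proof
        fix z assume "z \<in> ball j (32 * ?r)"
        then show "z \<in> ball y (37 * ?r)" using dist_triangle[of y z j] yj by (simp add: dist_commute)
      qed
      have "ennreal (2 * a) * vol (ball y (38 * ?r)) \<le> ennreal (2 * a) * vol (ball y (2 * (32 * ?r)))"
        using r by (intro mult_left_mono emeasure_mono) auto
      also have "vol (ball y (2 * (32 * ?r))) = ennreal (2 ^ DIM('a)) * vol (ball j (32 * ?r))"
        using r by (intro emeasure_ball_scale) auto
      also have "ennreal (2 * a) * (ennreal (2 ^ DIM('a)) * vol (ball j (32 * ?r)))
          = ennreal (2 * a * 2 ^ DIM('a)) * vol (ball j (32 * ?r))"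
        using a by (intro ennreal_mult_assoc) auto
      also have "2 * a * 2 ^ DIM('a) = \<epsilon> * t" by (simp add: a_def)
      also note large
      also have "(\<integral>\<^sup>+z\<in>ball j (32 * ?r). F z \<partial>lebesgue) \<le> (\<integral>\<^sup>+z\<in>ball y (37 * ?r). F z \<partial>lebesgue)"
        using sub by (rule nn_set_integral_mono_set)
      also have "\<dots> \<le> (\<integral>\<^sup>+z\<in>ball y (37 * ?r + 1). unit_mean F z \<partial>lebesgue)"
        using F_meas by (rule ball_integral_le_unit_mean)
      also have "\<dots> \<le> (\<integral>\<^sup>+z\<in>ball y (38 * ?r). unit_mean F z \<partial>lebesgue)"
        using r by (intro nn_set_integral_mono_set subset_ball) auto
      finally have "y \<in> F_large a"
        using yR r by (auto simp: F_large_def intro!: exI[of _ "38 * ?r"])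
      then show ?thesis using WF(2) by blast
    qed
  qed
  moreover have "WK \<union> WF \<union> WG \<in> sets lebesgue" using WK(1) WF(1) WG by (intro sets.Un)
  moreover have "vol (WK \<union> WF \<union> WG)
    \<le> ennreal (10 ^ DIM('a) * \<kappa> * \<Lambda> powr (- (q / 2))) * vol (ball 0 (R / 2))
      + ennreal (10 ^ DIM('a) * (2 * 2 ^ DIM('a) * ts / (\<epsilon> * t)) powr (p / 2)) * vol (ball 0 (R / 2))
      + ennreal (160 ^ DIM('a) * (\<epsilon> / \<Lambda>)) * vol W0"
  proof -
    have "vol (WK \<union> WF \<union> WG) \<le> vol (WK \<union> WF) + vol WG"
      using WK(1) WF(1) WG by (intro emeasure_subadditive) auto
    also have "\<dots> \<le> vol WK + vol WF + vol WG"
      using WK(1) WF(1) by (intro add_right_mono emeasure_subadditive) auto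
    also have "\<dots> \<le> ennreal (10 ^ DIM('a) * \<kappa> * \<Lambda> powr (- (q / 2))) * vol (ball 0 (R / 2))
      + ennreal (10 ^ DIM('a) * (2 * 2 ^ DIM('a) * ts / (\<epsilon> * t)) powr (p / 2)) * vol (ball 0 (R / 2))
      + ennreal (160 ^ DIM('a) * (\<epsilon> / \<Lambda>)) * vol W0"
      by (intro add_mono vol_WK vol_WF vol_WG)
    finally show ?thesis .
  qed
  ultimately show thesis using that unfolding T_def by blast
qed

end

section \<open>The decay exponent\<close>

text \<open>Besides \<open>s = (p / 2) (1 - \<theta>)\<close>, the iteration needs the two inequalities between \<open>s\<close>, \<open>q\<close> and \<open>\<theta>\<close> at the
end: the first keeps the jump \<open>\<Lambda>\<close> below the square root of the level, the second allows
the term with \<open>\<epsilon> / \<Lambda>\<close> to be absorbed. Both follow from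
\<open>2 s / (q \<theta>) = 2 (q - p) / (q (p + 2)) \<le> 2 / (p + 2)\<close>.\<close>

lemma decay_exponent:
  fixes p q :: real
  assumes "2 < p" "p < q"
  defines "s \<equiv> p * (q - p) / (p\<^sup>2 + 2 * q)" and "\<theta> \<equiv> (p\<^sup>2 + 2 * p) / (p\<^sup>2 + 2 * q)"
  shows "0 < s" "0 < \<theta>" "\<theta> < 1" "s = p / 2 * (1 - \<theta>)"
    "2 * s / q \<le> \<theta> / 2" "2 * s / q * s \<le> \<theta>"
proof -
  have d: "0 < p\<^sup>2 + 2 * q" using assms by (simp add: add_pos_pos)
  show s: "0 < s" using assms d by (simp add: s_def)
  show \<theta>: "0 < \<theta>" using assms d by (simp add: \<theta>_def add_pos_pos)
  show "\<theta> < 1" using assms d by (simp add: \<theta>_def)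
  show s_eq: "s = p / 2 * (1 - \<theta>)" using d by (simp add: s_def \<theta>_def field_simps power2_eq_square)
  have eq: "2 * s / q = \<theta> * (2 * (q - p) / (q * (p + 2)))"
  proof -
    have "\<theta> = p * (p + 2) / (p\<^sup>2 + 2 * q)" by (simp add: \<theta>_def power2_eq_square algebra_simps)
    then show ?thesis using assms(1,2) by (simp add: s_def)
  qed
  have b: "2 * (q - p) / (q * (p + 2)) \<le> 2 / (p + 2)"
    using assms(1,2) by (simp add: divide_simps)
  have "2 / (p + 2) \<le> 1 / 2" using assms(1) by (simp add: divide_simps)
  with b have "2 * (q - p) / (q * (p + 2)) \<le> 1 / 2" by (rule order_trans)
  then have "\<theta> * (2 * (q - p) / (q * (p + 2))) \<le> \<theta> * (1 / 2)" using \<theta> by (intro mult_left_mono) auto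
  then show "2 * s / q \<le> \<theta> / 2" unfolding eq by simp
  have "2 * s / q * s \<le> \<theta> * (2 / (p + 2)) * (p / 2)"
  proof (rule mult_mono)
    show "2 * s / q \<le> \<theta> * (2 / (p + 2))" unfolding eq using b \<theta> by (intro mult_left_mono) auto
    have "p / 2 * (1 - \<theta>) \<le> p / 2 * 1" using assms(1) \<theta> by (intro mult_left_mono) auto
    then show "s \<le> p / 2" unfolding s_eq[symmetric] by simp
  qed (use assms(1) s \<theta> in auto)
  also have "\<dots> = \<theta> * (p / (p + 2))" using assms(1) by (simp add: field_simps)
  also have "\<dots> \<le> \<theta> * 1" using assms(1) \<theta> by (intro mult_left_mono) auto
  finally show "2 * s / q * s \<le> \<theta>" by simp
qed

text \<open>Choice of the jump. With \<open>\<tau>\<close> the level in units of \<open>t\<^sub>*\<close> and \<open>Z = \<kappa>\<^bsup>2/p\<^esup> \<tau>\<close>, the term of \<open>K\<close> in an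
iteration step has the desired size \<open>\<kappa>\<^bsup>\<theta>\<^esup> \<tau>\<^bsup>-s\<^esup>\<close> if \<open>\<Lambda>\<^bsup>q/2\<^esup> = Z\<^sup>s\<close>, and the term of \<open>F\<close> has it if
\<open>\<epsilon>\<close> is of order \<open>\<Lambda> Z\<^bsup>-\<theta>\<^esup>\<close>; both identities use \<open>s = (p / 2) (1 - \<theta>)\<close>. The remaining term is then
controlled by \<open>Z\<^bsup>-\<theta>\<^esup> \<Lambda>\<^sup>s \<le> 1\<close>. The assumption that the claimed bound is nontrivial
gives \<open>\<kappa>\<^bsup>\<theta>\<^esup> < \<tau>\<^sup>s\<close>, that is, \<open>Z \<le> \<tau>\<^bsup>1/\<theta>\<^esup>\<close>, whence \<open>\<Lambda> \<le> \<tau>\<^bsup>1/2\<^esup>\<close> and the level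
\<open>\<tau> / \<Lambda>\<close> from which the step starts is still large.\<close>

lemma iteration_parameters:
  fixes p q s \<theta> C M \<kappa> \<tau> :: real
  assumes pq: "2 < p" "p < q" and s: "0 < s" "s = p / 2 * (1 - \<theta>)" and \<theta>: "0 < \<theta>" "\<theta> < 1"
    and sq: "2 * s / q \<le> \<theta> / 2" "2 * s / q * s \<le> \<theta>"
    and M: "1 \<le> M" and C: "1 \<le> C" "M powr (2 * s) \<le> C" and \<kappa>: "1 \<le> \<kappa>"
    and \<tau>: "0 < \<tau>" "C * \<kappa> powr \<theta> * \<tau> powr (- s) < 1"
  defines "Z \<equiv> \<kappa> powr (2 / p) * \<tau>"
  defines "\<Lambda> \<equiv> Z powr (2 * s / q)"
  shows "0 < Z" "1 \<le> \<Lambda>" "\<Lambda> \<le> Z powr \<theta>" "M \<le> \<tau> / \<Lambda>"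
    "\<kappa> * \<Lambda> powr (- (q / 2)) = \<kappa> powr \<theta> * \<tau> powr (- s)"
    "(Z powr \<theta> / \<tau>) powr (p / 2) = \<kappa> powr \<theta> * \<tau> powr (- s)"
    "Z powr (- \<theta>) * \<Lambda> powr s \<le> 1"
proof -
  have \<kappa>\<theta>: "1 \<le> \<kappa> powr \<theta>" using \<kappa> \<theta> by (simp add: ge_one_powr_ge_zero)
  have \<tau>s: "C * \<kappa> powr \<theta> < \<tau> powr s" using \<tau> by (simp add: powr_minus_divide)
  have "1 * 1 \<le> C * \<kappa> powr \<theta>" using C(1) \<kappa>\<theta> by (intro mult_mono) auto
  with \<tau>s have "1 < \<tau> powr s" by linarith
  then have \<tau>1: "1 < \<tau>" using \<tau>(1) s(1) by (smt (verit) powr_le1)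
  have "1 * 1 \<le> \<kappa> powr (2 / p) * \<tau>"
    using \<kappa> pq \<tau>1 by (intro mult_mono ge_one_powr_ge_zero) auto
  then have Z1: "1 \<le> Z" by (simp add: Z_def)
  then show Z: "0 < Z" by simp
  have sq0: "0 \<le> 2 * s / q" using s(1) pq by simp
  show \<Lambda>1: "1 \<le> \<Lambda>" unfolding \<Lambda>_def using Z1 sq0 by (rule ge_one_powr_ge_zero)
  show "\<Lambda> \<le> Z powr \<theta>" unfolding \<Lambda>_def using Z1 sq(1) \<theta> by (intro powr_mono) auto
  have "2 * s / p = 1 - \<theta>" unfolding s(2) using pq by simp
  then have th: "\<theta> + 2 * s / p = 1" by simp
  have "\<kappa> powr \<theta> \<le> \<tau> powr s"
    using \<tau>s C(1) \<kappa>\<theta> mult_right_mono[of 1 C "\<kappa> powr \<theta>"] by linarith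
  then have "(\<kappa> powr \<theta>) powr (1 / \<theta> * (2 / p) ) \<le> (\<tau> powr s) powr (1 / \<theta> * (2 / p))"
    using \<theta> pq by (intro powr_mono2) auto
  then have "\<kappa> powr (2 / p) \<le> \<tau> powr (s * (1 / \<theta> * (2 / p)))"
    using \<theta> by (simp add: powr_powr)
  then have "Z \<le> \<tau> powr (s * (1 / \<theta> * (2 / p))) * \<tau>" unfolding Z_def using \<tau>(1) by (intro mult_right_mono) auto
  also have "\<dots> = \<tau> powr (s * (1 / \<theta> * (2 / p)) + 1)" using \<tau>(1) by (simp add: powr_add)
  also have "s * (1 / \<theta> * (2 / p)) + 1 = 1 / \<theta>"
    using th \<theta> pq by (simp add: field_simps)
  finally have "Z \<le> \<tau> powr (1 / \<theta>)" .
  then have "\<Lambda> \<le> (\<tau> powr (1 / \<theta>)) powr (2 * s / q)"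
    unfolding \<Lambda>_def using Z sq0 by (intro powr_mono2) auto
  also have "\<dots> = \<tau> powr (1 / \<theta> * (2 * s / q))" by (simp add: powr_powr)
  also have "\<dots> \<le> \<tau> powr (1 / 2)"
  proof (rule powr_mono)
    have "1 / \<theta> * (2 * s / q) \<le> 1 / \<theta> * (\<theta> / 2)" using sq(1) \<theta> by (intro mult_left_mono) auto
    then show "1 / \<theta> * (2 * s / q) \<le> 1 / 2" using \<theta> by simp
  qed (use \<tau>1 in auto)
  finally have \<Lambda>\<tau>: "\<Lambda> \<le> \<tau> powr (1 / 2)" .
  have "M powr (2 * s) \<le> \<tau> powr s"
    using \<tau>s C \<kappa>\<theta> mult_left_mono[of 1 "\<kappa> powr \<theta>" C] by linarith
  then have "(M powr (2 * s)) powr (1 / (2 * s)) \<le> (\<tau> powr s) powr (1 / (2 * s))"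
    using s(1) by (intro powr_mono2) auto
  then have M\<tau>: "M \<le> \<tau> powr (1 / 2)" using s(1) M by (simp add: powr_powr)
  have "M * \<Lambda> \<le> \<tau> powr (1 / 2) * \<tau> powr (1 / 2)"
    using M\<tau> \<Lambda>\<tau> M \<Lambda>1 by (intro mult_mono) auto
  also have "\<dots> = \<tau>" using \<tau>(1) by (simp add: powr_add[symmetric])
  finally show "M \<le> \<tau> / \<Lambda>" using \<Lambda>1 by (simp add: pos_le_divide_eq)
  have "\<Lambda> powr (- (q / 2)) = Z powr (- s)" unfolding \<Lambda>_def using pq by (simp add: powr_powr)
  also have "\<dots> = \<kappa> powr (2 / p * - s) * \<tau> powr (- s)"
    unfolding Z_def using \<kappa> \<tau>(1) by (simp add: powr_mult powr_powr)
  finally have "\<kappa> * \<Lambda> powr (- (q / 2)) = \<kappa> powr (1 + 2 / p * - s) * \<tau> powr (- s)"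
    using \<kappa> powr_add[of \<kappa> 1 "2 / p * - s"] by simp
  also have "1 + 2 / p * - s = 1 - 2 * s / p" by simp
  also have "\<dots> = \<theta>" using th by linarith
  finally show "\<kappa> * \<Lambda> powr (- (q / 2)) = \<kappa> powr \<theta> * \<tau> powr (- s)" .
  have "Z powr \<theta> / \<tau> = \<kappa> powr (2 / p * \<theta>) * \<tau> powr (\<theta> - 1)"
    unfolding Z_def using \<kappa> \<tau>(1) by (simp add: powr_mult powr_powr powr_diff)
  then have "(Z powr \<theta> / \<tau>) powr (p / 2) = \<kappa> powr (2 / p * \<theta> * (p / 2)) * \<tau> powr ((\<theta> - 1) * (p / 2))"
    using \<kappa> \<tau>(1) by (simp add: powr_mult powr_powr)
  also have "2 / p * \<theta> * (p / 2) = \<theta>" using pq by simp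
  also have "(\<theta> - 1) * (p / 2) = - s"
    unfolding s(2) by (metis minus_diff_eq minus_mult_right mult.commute)
  finally show "(Z powr \<theta> / \<tau>) powr (p / 2) = \<kappa> powr \<theta> * \<tau> powr (- s)" .
  have "\<Lambda> powr s = Z powr (2 * s / q * s)" unfolding \<Lambda>_def by (simp add: powr_powr)
  also have "\<dots> \<le> Z powr \<theta>" using sq(2) Z1 by (intro powr_mono) auto
  finally have "Z powr (- \<theta>) * \<Lambda> powr s \<le> Z powr (- \<theta>) * Z powr \<theta>" by (intro mult_left_mono) auto
  also have "\<dots> = 1" using Z by (simp add: powr_add[symmetric])
  finally show "Z powr (- \<theta>) * \<Lambda> powr s \<le> 1" .
qed

context coarse_comparison
begin

text \<open>Induction on the level, in dyadic steps. Where the claimed bound exceeds the measure of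
\<open>B\<^sub>R\<^sub>/\<^sub>2\<close> there is nothing to prove. Otherwise the iteration step
is applied with the parameters chosen above, and the
constants \<open>c\<close> and \<open>C\<close> are such that each of its three terms is at most a third of the bound.\<close>

lemma level_set_decay:
  fixes s \<theta> c C \<tau> :: real
  assumes s: "0 < s" "s = p / 2 * (1 - \<theta>)" and \<theta>: "0 < \<theta>" "\<theta> < 1"
    and sq: "2 * s / q \<le> \<theta> / 2" "2 * s / q * s \<le> \<theta>"
    and c: "0 < c" "3 * (160 ^ DIM('a) * (48 * 8 ^ DIM('a)) powr s) * c = 1"
    and C: "3 * 10 ^ DIM('a) \<le> C"
      "3 * 10 ^ DIM('a) * (2 * 2 ^ DIM('a) * (48 * 4 ^ DIM('a)) / c) powr (p / 2) \<le> C"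
      "(160 ^ DIM('a) * (48 * 4 ^ DIM('a))) powr (2 * s) \<le> C"
    and \<tau>: "0 < \<tau>"
  obtains W where "W \<in> sets lebesgue" "level_set G R (\<tau> * ts) \<subseteq> W"
    "vol W \<le> ennreal (C * \<kappa> powr \<theta> * \<tau> powr (- s)) * vol (ball 0 (R / 2))"
proof -
  have N1: "(1::real) \<le> 4 ^ DIM('a)" "(1::real) \<le> 8 ^ DIM('a)"
      "(1::real) \<le> 10 ^ DIM('a)" "(1::real) \<le> 160 ^ DIM('a)"
    by (rule one_le_power, simp)+
  have C1: "1 \<le> C" using C(1) N1(3) by linarith
  have c1: "c \<le> 1"
  proof -
    have "1 * 1 * c \<le> 3 * (160 ^ DIM('a) * (48 * 8 ^ DIM('a)) powr s) * c"
    proof (intro mult_right_mono)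
      have "1 \<le> 48 * (8::real) ^ DIM('a)" using N1(2) by linarith
      then have "1 \<le> (48 * 8 ^ DIM('a)) powr s" using s(1) by (intro ge_one_powr_ge_zero) auto
      then have "1 * 1 \<le> 160 ^ DIM('a) * (48 * 8 ^ DIM('a)) powr s"
        using N1(4) by (intro mult_mono) auto
      then show "1 * 1 \<le> 3 * (160 ^ DIM('a) * (48 * 8 ^ DIM('a)) powr s)" by linarith
    qed (use c in auto)
    then show ?thesis using c(2) by linarith
  qed
  have \<kappa>\<theta>: "1 \<le> \<kappa> powr \<theta>" using \<kappa>_ge \<theta> by (simp add: ge_one_powr_ge_zero)
  let ?B = "ball (0::'a) (R / 2)"
  have trivial: "\<exists>W. W \<in> sets lebesgue \<and> level_set G R (\<tau> * ts) \<subseteq> W \<and>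
      vol W \<le> ennreal (C * \<kappa> powr \<theta> * \<tau> powr (- s)) * vol ?B"
    if "1 \<le> C * \<kappa> powr \<theta> * \<tau> powr (- s)" for \<tau>
  proof (intro exI conjI)
    show "level_set G R (\<tau> * ts) \<subseteq> ?B" unfolding level_set_def by blast
    have "1 * vol ?B \<le> ennreal (C * \<kappa> powr \<theta> * \<tau> powr (- s)) * vol ?B"
      using that by (intro mult_right_mono) auto
    then show "vol ?B \<le> ennreal (C * \<kappa> powr \<theta> * \<tau> powr (- s)) * vol ?B" by simp
  qed simp
  have "\<exists>W. W \<in> sets lebesgue \<and> level_set G R (\<tau> * ts) \<subseteq> W \<and>
      vol W \<le> ennreal (C * \<kappa> powr \<theta> * \<tau> powr (- s)) * vol ?B"
    if "0 < \<tau>" "\<tau> \<le> 2 ^ k" for \<tau> k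
    using that
  proof (induction k arbitrary: \<tau>)
    case 0
    then have "\<tau> powr (- s) \<ge> 1" using s(1) by (auto simp: powr_minus_divide powr_le1)
    then have "1 * 1 * 1 \<le> C * \<kappa> powr \<theta> * \<tau> powr (- s)"
      using C1 \<kappa>\<theta> by (intro mult_mono) auto
    then show ?case by (intro trivial) simp
  next
    case (Suc k)
    show ?case
    proof (cases "1 \<le> C * \<kappa> powr \<theta> * \<tau> powr (- s)")
      case True
      then show ?thesis by (rule trivial)
    next
      case False
      define M :: real where "M = 160 ^ DIM('a) * (48 * 4 ^ DIM('a))"
      have M1: "1 \<le> M"
      proof -
        have "1 \<le> 48 * (4::real) ^ DIM('a)" using N1(1) by linarith
        then have "1 * 1 \<le> M" unfolding M_def using N1(4) by (intro mult_mono) auto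
        then show ?thesis by simp
      qed
      define Z where "Z = \<kappa> powr (2 / p) * \<tau>"
      define \<Lambda> where "\<Lambda> = Z powr (2 * s / q)"
      note par = iteration_parameters[OF p_gt q_gt s \<theta> sq M1 C1 C(3)[folded M_def] \<kappa>_ge
          Suc.prems(1), folded Z_def, folded \<Lambda>_def]
      have Z: "0 < Z" and \<Lambda>1: "1 \<le> \<Lambda>" and \<Lambda>Z: "\<Lambda> \<le> Z powr \<theta>" and M\<tau>: "M \<le> \<tau> / \<Lambda>"
        and par1: "\<kappa> * \<Lambda> powr (- (q / 2)) = \<kappa> powr \<theta> * \<tau> powr (- s)"
        and par2: "(Z powr \<theta> / \<tau>) powr (p / 2) = \<kappa> powr \<theta> * \<tau> powr (- s)"
        and par3: "Z powr (- \<theta>) * \<Lambda> powr s \<le> 1"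
        using par False by auto
      define \<epsilon> where "\<epsilon> = c * \<Lambda> * Z powr (- \<theta>)"
      define t where "t = \<tau> * ts / (48 * 4 ^ DIM('a) * \<Lambda>)"
      define \<tau>' where "\<tau>' = \<tau> / (48 * 8 ^ DIM('a) * \<Lambda>)"
      define X where "X = \<kappa> powr \<theta> * \<tau> powr (- s)"
      have X0: "0 \<le> X" by (simp add: X_def)
      have \<epsilon>0: "0 < \<epsilon>" using c Z \<Lambda>1 by (simp add: \<epsilon>_def)
      have "c * (\<Lambda> / Z powr \<theta>) \<le> 1 * 1" using c(1) c1 \<Lambda>Z \<Lambda>1 Z by (intro mult_mono) auto
      then have \<epsilon>1: "\<epsilon> \<le> 1" by (simp add: \<epsilon>_def powr_minus_divide)
      have t_ge: "160 ^ DIM('a) * ts \<le> t"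
      proof -
        have "160 ^ DIM('a) \<le> \<tau> / \<Lambda> / (48 * 4 ^ DIM('a))"
          using M\<tau> unfolding M_def by (subst pos_le_divide_eq) auto
        then have "160 ^ DIM('a) * ts \<le> \<tau> / \<Lambda> / (48 * 4 ^ DIM('a)) * ts"
          using ts_pos by (intro mult_right_mono) auto
        also have "\<dots> = t" by (simp add: t_def mult_ac)
        finally show ?thesis .
      qed
      have t_div: "t / 2 ^ DIM('a) = \<tau>' * ts"
      proof -
        have "(8::real) ^ DIM('a) = 4 ^ DIM('a) * 2 ^ DIM('a)"
          unfolding power_mult_distrib[symmetric] by simp
        then show ?thesis by (simp add: t_def \<tau>'_def mult_ac)
      qed
      have \<tau>'0: "0 < \<tau>'" using Suc.prems(1) \<Lambda>1 by (simp add: \<tau>'_def)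
      \<comment> \<open>The level \<open>t / 2\<^sup>d\<close> in the last term of the step is where the induction hypothesis enters.\<close>
      have "\<tau>' \<le> \<tau> / 2"
        unfolding \<tau>'_def
      proof (rule divide_left_mono)
        have "2 \<le> 48 * (8::real) ^ DIM('a)" using N1(2) by linarith
        then have "2 * 1 \<le> (48 * 8 ^ DIM('a)) * \<Lambda>"
          using \<Lambda>1 by (intro mult_mono) auto
        then show "2 \<le> 48 * 8 ^ DIM('a) * \<Lambda>" by simp
      qed (use Suc.prems \<Lambda>1 in auto)
      then have "\<tau>' \<le> 2 ^ k" using Suc.prems(2) by simp
      then obtain W0 where W0: "W0 \<in> sets lebesgue" "level_set G R (t / 2 ^ DIM('a)) \<subseteq> W0"
        "vol W0 \<le> ennreal (C * \<kappa> powr \<theta> * \<tau>' powr (- s)) * vol ?B"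
        using Suc.IH[OF \<tau>'0] unfolding t_div by blast
      obtain W where W: "W \<in> sets lebesgue" "level_set G R (48 * 4 ^ DIM('a) * \<Lambda> * t) \<subseteq> W"
        and vol_W: "vol W \<le> ennreal (10 ^ DIM('a) * \<kappa> * \<Lambda> powr (- (q / 2))) * vol ?B
          + ennreal (10 ^ DIM('a) * (2 * 2 ^ DIM('a) * ts / (\<epsilon> * t)) powr (p / 2)) * vol ?B
          + ennreal (160 ^ DIM('a) * (\<epsilon> / \<Lambda>)) * vol W0"
        using level_set_step[OF t_ge \<epsilon>0 \<epsilon>1 \<Lambda>1 W0(1,2)] by blast
      have bound1: "10 ^ DIM('a) * \<kappa> * \<Lambda> powr (- (q / 2)) \<le> C / 3 * X"
      proof -
        have "10 ^ DIM('a) * \<kappa> * \<Lambda> powr (- (q / 2)) = 10 ^ DIM('a) * X"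
          using par1 by (simp add: X_def mult.assoc)
        also have "\<dots> \<le> C / 3 * X" using C(1) X0 by (intro mult_right_mono) auto
        finally show ?thesis .
      qed
      have bound2: "10 ^ DIM('a) * (2 * 2 ^ DIM('a) * ts / (\<epsilon> * t)) powr (p / 2) \<le> C / 3 * X"
      proof -
        have "2 * 2 ^ DIM('a) * ts / (\<epsilon> * t) = (2 * 2 ^ DIM('a) * (48 * 4 ^ DIM('a)) / c) * (Z powr \<theta> / \<tau>)"
          using ts_pos \<Lambda>1 Z by (simp add: \<epsilon>_def t_def powr_minus_divide)
        then have "(2 * 2 ^ DIM('a) * ts / (\<epsilon> * t)) powr (p / 2)
            = (2 * 2 ^ DIM('a) * (48 * 4 ^ DIM('a)) / c) powr (p / 2) * X"
          using par2 c Z Suc.prems(1) by (simp only: X_def powr_mult)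
        then have "10 ^ DIM('a) * (2 * 2 ^ DIM('a) * ts / (\<epsilon> * t)) powr (p / 2)
            = (10 ^ DIM('a) * (2 * 2 ^ DIM('a) * (48 * 4 ^ DIM('a)) / c) powr (p / 2)) * X"
          by (simp only: mult.assoc)
        also have "\<dots> \<le> C / 3 * X" using C(2) X0 by (intro mult_right_mono) auto
        finally show ?thesis .
      qed
      have bound3: "160 ^ DIM('a) * (\<epsilon> / \<Lambda>) * (C * \<kappa> powr \<theta> * \<tau>' powr (- s)) \<le> C / 3 * X"
      proof -
        have "\<tau>' powr (- s) = (48 * 8 ^ DIM('a)) powr s * \<Lambda> powr s * \<tau> powr (- s)"
        proof -
          have "\<tau>' powr (- s) = \<tau> powr (- s) / ((48 * 8 ^ DIM('a)) powr (- s) * \<Lambda> powr (- s))"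
            unfolding \<tau>'_def using \<Lambda>1 Suc.prems(1) by (simp only: powr_divide powr_mult)
          then show ?thesis by (simp add: powr_minus_divide)
        qed
        moreover have "\<epsilon> / \<Lambda> = c * Z powr (- \<theta>)" using \<Lambda>1 by (simp add: \<epsilon>_def)
        ultimately have "160 ^ DIM('a) * (\<epsilon> / \<Lambda>) * (C * \<kappa> powr \<theta> * \<tau>' powr (- s))
          = (3 * (160 ^ DIM('a) * (48 * 8 ^ DIM('a)) powr s) * c) * (C / 3 * X) * (Z powr (- \<theta>) * \<Lambda> powr s)"
          unfolding X_def by (simp only: mult_ac times_divide_eq_right) simp
        also have "\<dots> \<le> (3 * (160 ^ DIM('a) * (48 * 8 ^ DIM('a)) powr s) * c) * (C / 3 * X) * 1"
          using par3 C1 X0 c by (intro mult_left_mono) auto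
        also have "\<dots> = C / 3 * X" using c(2) by simp
        finally show ?thesis .
      qed
      have "vol W \<le> ennreal (C / 3 * X) * vol ?B + ennreal (C / 3 * X) * vol ?B + ennreal (C / 3 * X) * vol ?B"
      proof (rule order_trans[OF vol_W], intro add_mono)
        have "ennreal (160 ^ DIM('a) * (\<epsilon> / \<Lambda>)) * vol W0
          \<le> ennreal (160 ^ DIM('a) * (\<epsilon> / \<Lambda>)) * (ennreal (C * \<kappa> powr \<theta> * \<tau>' powr (- s)) * vol ?B)"
          using W0(3) by (rule mult_left_mono) simp
        also have "\<dots> = ennreal (160 ^ DIM('a) * (\<epsilon> / \<Lambda>) * (C * \<kappa> powr \<theta> * \<tau>' powr (- s))) * vol ?B"
          using \<epsilon>0 \<Lambda>1 C1 by (intro ennreal_mult_assoc) auto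
        also have "\<dots> \<le> ennreal (C / 3 * X) * vol ?B"
          using bound3 by (intro mult_right_mono ennreal_leI) auto
        finally show "ennreal (160 ^ DIM('a) * (\<epsilon> / \<Lambda>)) * vol W0 \<le> ennreal (C / 3 * X) * vol ?B" .
      qed (intro mult_right_mono ennreal_leI bound1 bound2; simp)+
      also have "\<dots> = ennreal (C * X) * vol ?B"
      proof -
        have "ennreal (C * X) = ennreal (C / 3 * X + C / 3 * X + C / 3 * X)" by simp
        also have "\<dots> = ennreal (C / 3 * X) + ennreal (C / 3 * X) + ennreal (C / 3 * X)"
          using C1 X0 by (subst ennreal_plus, simp, simp)+
        finally show ?thesis by (simp only: distrib_right)
      qed
      finally have "vol W \<le> ennreal (C * \<kappa> powr \<theta> * \<tau> powr (- s)) * vol ?B"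
        by (simp add: X_def mult.assoc)
      moreover have "48 * 4 ^ DIM('a) * \<Lambda> * t = \<tau> * ts"
        using \<Lambda>1 by (simp add: t_def)
      ultimately show ?thesis using W by auto
    qed
  qed
  moreover obtain k where "\<tau> \<le> 2 ^ k"
    using real_arch_pow[of 2 \<tau>] by (auto intro: less_imp_le)
  ultimately show thesis using \<tau> that by blast
qed

end

section \<open>Gradients as an instance\<close>

lemma avg_ball_const: "0 < r \<Longrightarrow> avg (ball (x::'a::euclidean_space) r) (\<lambda>_. c) = c"
  using emeasure_ball_pos_finite[of r x]
  by (simp add: avg_def nn_integral_cmult_indicator ennreal_times_divide[symmetric])

lemma coarse_norm_1_1:
  "coarse_norm 1 1 U \<phi> = avg U (unit_mean (\<lambda>y. ennreal \<bar>\<phi> y\<bar>))"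
  by (simp add: coarse_norm_def epowr_one unit_mean_def[abs_def])

text \<open>The outer root of the coarsened norm is undone here, so that the bound can be used as one for an
integral.\<close>

lemma coarse_norm_1_le_D:
  assumes "0 < b" "0 \<le> c" "coarse_norm 1 b U \<phi> \<le> ennreal c"
  shows "avg U (\<lambda>x. epowr (unit_mean (\<lambda>y. ennreal \<bar>\<phi> y\<bar>) x) b) \<le> ennreal (c powr b)"
proof -
  define A where "A = avg U (\<lambda>x. epowr (unit_mean (\<lambda>y. ennreal \<bar>\<phi> y\<bar>) x) b)"
  have A: "epowr A (1 / b) \<le> ennreal c"
    using assms(3) by (simp add: coarse_norm_def A_def unit_mean_def)
  have "A \<le> ennreal (c powr b)"
  proof (cases A)
    case (real r)
    then have "r powr (1 / b) \<le> c" using A assms by (simp add: epowr_ennreal)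
    then have "(r powr (1 / b)) powr b \<le> c powr b" using assms by (intro powr_mono2) auto
    then show ?thesis using real assms by (simp add: powr_powr ennreal_leI)
  next
    case top
    then show ?thesis using A assms by (simp add: epowr_pos top_unique)
  qed
  then show ?thesis by (simp add: A_def)
qed

lemma zero_ext_measurable:
  assumes "\<phi> \<in> borel_measurable (lebesgue_on U)" "U \<in> sets lebesgue"
  shows "zero_ext U \<phi> \<in> borel_measurable lebesgue"
  unfolding zero_ext_def[abs_def] using assms by (rule borel_measurable_if_I)

lemma level_set_coarse_maximal:
  "{x \<in> ball 0 (R / 2). coarse_maximal 1 \<phi> x > ennreal t}
    = level_set (\<lambda>y. ennreal \<bar>\<phi> y\<bar>) R t"
  by (auto simp: coarse_maximal_def level_set_def less_SUP_iff)

lemma norm_sq_triangle: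
  fixes a b :: "'a::real_inner"
  shows "(norm a)\<^sup>2 \<le> 2 * (norm (a - b))\<^sup>2 + 2 * (norm b)\<^sup>2"
proof -
  have "norm a \<le> norm (a - b) + norm b" using norm_triangle_ineq[of "a - b" b] by simp
  then have "(norm a)\<^sup>2 \<le> (norm (a - b) + norm b)\<^sup>2" by (intro power_mono) auto
  also have "\<dots> \<le> 2 * (norm (a - b))\<^sup>2 + 2 * (norm b)\<^sup>2"
    using sum_squares_ge_zero[of "norm (a - b) - norm b" 0]
    by (simp add: power2_eq_square algebra_simps)
  finally show ?thesis .
qed

text \<open>The relations between \<open>G\<close>, \<open>D\<close> and \<open>V\<close> are the triangle inequality in squared form. All three
functions are extended by zero to become measurable on the whole space; since \<open>r \<ge> 4\<close>, unit balls
centred in \<open>B\<^sub>r\<^sub>/\<^sub>4(x)\<close> stay inside \<open>B\<^sub>r\<^sub>/\<^sub>2(x)\<close>, so the extension does not affect the interior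
estimate.\<close>

lemma coarse_comparison_gradient:
  fixes u f K :: "'a::euclidean_space \<Rightarrow> real"
  assumes R: "10 \<le> R" and pq: "2 < p" "p < q" and ts: "0 < ts" and \<kappa>: "1 \<le> \<kappa>"
    and f: "f \<in> L2 (ball 0 R)" and u: "u \<in> H1 (ball 0 R)"
    and K: "K \<in> borel_measurable lebesgue" "\<And>x. 1 \<le> K x"
    and approx: "\<And>r x0. r \<in> {4..R / 2} \<Longrightarrow> x0 \<in> ball 0 (R / 2) \<Longrightarrow>
          (INF v\<in>class_A x0 (r / 2) K.
             avg (ball x0 (r / 2)) (\<lambda>x. ennreal ((norm
               (weak_grad (ball 0 R) u x - weak_grad (ball x0 (r / 2)) v x))\<^sup>2)))
          \<le> avg (ball x0 r) (\<lambda>x. ennreal (\<bar>f x\<bar>\<^sup>2))"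
  defines "grad2 \<equiv> zero_ext (ball 0 R) (\<lambda>x. (norm (weak_grad (ball 0 R) u x))\<^sup>2)"
    and "f2 \<equiv> zero_ext (ball 0 R) (\<lambda>x. (f x)\<^sup>2)"
  assumes grad2_le: "coarse_norm 1 1 (ball 0 R) grad2 \<le> ennreal ts"
    and f2_le: "coarse_norm 1 (p / 2) (ball 0 R) f2 \<le> ennreal ts"
    and K_le: "coarse_norm 1 1 (ball 0 R) (\<lambda>x. K x powr (q / 2)) \<le> ennreal \<kappa>"
  shows "coarse_comparison (\<lambda>y. ennreal \<bar>grad2 y\<bar>) (\<lambda>y. ennreal \<bar>f2 y\<bar>) (\<lambda>y. ennreal (K y)) R p q ts \<kappa>"
proof
  define g where "g = weak_grad (ball 0 R) u"
  have g_meas: "g \<in> borel_measurable (lebesgue_on (ball 0 R))"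
    using u by (auto simp: H1_def L2_def g_def)
  have "grad2 \<in> borel_measurable lebesgue"
    unfolding grad2_def g_def[symmetric] using g_meas by (intro zero_ext_measurable) auto
  then show "(\<lambda>y. ennreal \<bar>grad2 y\<bar>) \<in> borel_measurable lebesgue" by measurable
  have "f2 \<in> borel_measurable lebesgue"
    unfolding f2_def using f by (intro zero_ext_measurable) (auto simp: L2_def)
  then show "(\<lambda>y. ennreal \<bar>f2 y\<bar>) \<in> borel_measurable lebesgue" by measurable
  show "(\<lambda>y. ennreal (K y)) \<in> borel_measurable lebesgue" using K(1) by measurable
  show "10 \<le> R" "2 < p" "p < q" "0 < ts" "1 \<le> \<kappa>" by fact+
  show "ennreal \<bar>grad2 x\<bar> = 0" if "x \<notin> ball 0 R" for x
    using that by (simp add: grad2_def zero_ext_def)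
  show "(\<integral>\<^sup>+x\<in>ball 0 R. unit_mean (\<lambda>y. ennreal \<bar>grad2 y\<bar>) x \<partial>lebesgue)
      \<le> ennreal ts * emeasure lebesgue (ball (0::'a) R)"
    using grad2_le R unfolding coarse_norm_1_1 by (simp add: avg_ball_le_iff)
  show "(\<integral>\<^sup>+x\<in>ball 0 R. epowr (unit_mean (\<lambda>y. ennreal \<bar>f2 y\<bar>) x) (p / 2) \<partial>lebesgue)
      \<le> ennreal (ts powr (p / 2)) * emeasure lebesgue (ball (0::'a) R)"
    using coarse_norm_1_le_D[OF _ _ f2_le] pq ts R by (simp add: avg_ball_le_iff)
  have "epowr (ennreal (K y)) (q / 2) = ennreal \<bar>K y powr (q / 2)\<bar>" for y
    using pq K(2)[of y] by (subst epowr_ennreal) auto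
  then show "(\<integral>\<^sup>+x\<in>ball 0 R. unit_mean (\<lambda>y. epowr (ennreal (K y)) (q / 2)) x \<partial>lebesgue)
      \<le> ennreal \<kappa> * emeasure lebesgue (ball (0::'a) R)"
    using K_le R unfolding coarse_norm_1_1 by (simp add: avg_ball_le_iff)
  fix r x \<delta> assume r: "4 \<le> r" "r \<le> R / 2" and x: "x \<in> ball (0::'a) (R / 2)"
    and \<delta>: "avg (ball x r) (\<lambda>y. ennreal \<bar>f2 y\<bar>) < \<delta>"
  have sub: "ball x s \<subseteq> ball 0 R" if "s \<le> R / 2" for s
  proof
    fix z assume "z \<in> ball x s"
    moreover have "dist 0 z \<le> dist 0 x + dist x z" by (rule dist_triangle)
    ultimately show "z \<in> ball 0 R" using x that by auto
  qed
  have "avg (ball x r) (\<lambda>y. ennreal (\<bar>f y\<bar>\<^sup>2)) = avg (ball x r) (\<lambda>y. ennreal \<bar>f2 y\<bar>)"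
    using sub[OF r(2)] by (intro avg_ball_cong) (auto simp: f2_def zero_ext_def)
  then have "(INF v\<in>class_A x (r / 2) K. avg (ball x (r / 2)) (\<lambda>y. ennreal ((norm
       (g y - weak_grad (ball x (r / 2)) v y))\<^sup>2))) < \<delta>"
    using approx[of r x] r x \<delta> unfolding g_def by auto
  then obtain v where v: "v \<in> class_A x (r / 2) K"
    and v\<delta>: "avg (ball x (r / 2)) (\<lambda>y. ennreal ((norm (g y - weak_grad (ball x (r / 2)) v y))\<^sup>2)) < \<delta>"
    by (auto simp: INF_less_iff)
  define w where "w = weak_grad (ball x (r / 2)) v"
  have w_meas: "w \<in> borel_measurable (lebesgue_on (ball x (r / 2)))"
    using v by (auto simp: class_A_def H1_def L2_def w_def)
  have g_meas': "g \<in> borel_measurable (lebesgue_on (ball x (r / 2)))"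
    using g_meas sub[of "r / 2"] r by (intro measurable_restrict_mono[OF g_meas]) auto
  define D where "D = zero_ext (ball x (r / 2)) (\<lambda>y. (norm (g y - w y))\<^sup>2)"
  define V where "V = zero_ext (ball x (r / 2)) (\<lambda>y. (norm (w y))\<^sup>2)"
  have "D \<in> borel_measurable lebesgue"
    unfolding D_def using g_meas' w_meas by (intro zero_ext_measurable) auto
  then have D_meas: "(\<lambda>y. ennreal (D y)) \<in> borel_measurable lebesgue" by measurable
  have "V \<in> borel_measurable lebesgue"
    unfolding V_def using w_meas by (intro zero_ext_measurable) auto
  then have V_meas: "(\<lambda>y. ennreal (V y)) \<in> borel_measurable lebesgue" by measurable
  have in_ball: "D y = (norm (g y - w y))\<^sup>2" "V y = (norm (w y))\<^sup>2" "grad2 y = (norm (g y))\<^sup>2"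
    if "y \<in> ball x (r / 2)" for y
  proof -
    have "y \<in> ball 0 R" using sub[of "r / 2"] r that by auto
    then show "D y = (norm (g y - w y))\<^sup>2" "V y = (norm (w y))\<^sup>2" "grad2 y = (norm (g y))\<^sup>2"
      using that by (simp_all add: D_def V_def grad2_def zero_ext_def g_def)
  qed
  have to_ennreal: "ennreal a \<le> 2 * ennreal b + 2 * ennreal c"
    if "a \<le> 2 * b + 2 * c" "0 \<le> b" "0 \<le> c" for a b c
  proof -
    have "ennreal a \<le> ennreal (2 * b + 2 * c)" using that(1) by (rule ennreal_leI)
    also have "\<dots> = 2 * ennreal b + 2 * ennreal c" using that by (simp add: ennreal_mult)
    finally show ?thesis .
  qed
  have ineq: "ennreal \<bar>grad2 y\<bar> \<le> 2 * ennreal (D y) + 2 * ennreal (V y)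
      \<and> ennreal (V y) \<le> 2 * ennreal \<bar>grad2 y\<bar> + 2 * ennreal (D y)" if "y \<in> ball x (r / 2)" for y
  proof
    show "ennreal \<bar>grad2 y\<bar> \<le> 2 * ennreal (D y) + 2 * ennreal (V y)"
      using norm_sq_triangle[of "g y" "w y"] in_ball[OF that] by (intro to_ennreal) auto
    show "ennreal (V y) \<le> 2 * ennreal \<bar>grad2 y\<bar> + 2 * ennreal (D y)"
      using norm_sq_triangle[of "w y" "g y"] in_ball[OF that]
      by (intro to_ennreal) (auto simp: norm_minus_commute)
  qed
  have D\<delta>: "avg (ball x (r / 2)) (\<lambda>y. ennreal (D y)) < \<delta>"
    using v\<delta> avg_ball_cong[of x "r / 2" "\<lambda>y. ennreal (D y)" "\<lambda>y. ennreal ((norm (g y - w y))\<^sup>2)"] in_ball(1)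
    by (simp add: w_def)
  have VK: "unit_mean (\<lambda>y. ennreal (V y)) y \<le> ennreal (K y) * avg (ball x (r / 2)) (\<lambda>y. ennreal (V y))"
    if y: "y \<in> ball x (r / 4)" for y
  proof -
    have "ball y 1 \<subseteq> ball x (r / 2)"
    proof
      fix z assume "z \<in> ball y 1"
      then show "z \<in> ball x (r / 2)" using dist_triangle[of x z y] y r by simp
    qed
    then have "unit_mean (\<lambda>y. ennreal (V y)) y = avg (ball y 1) (\<lambda>y. ennreal ((norm (w y))\<^sup>2))"
      unfolding unit_mean_def using in_ball(2) by (intro avg_ball_cong) auto
    also have "\<dots> \<le> ennreal (K y) * avg (ball x (r / 2)) (\<lambda>y. ennreal ((norm (w y))\<^sup>2))"
      using v y by (simp add: class_A_def w_def)
    also have "avg (ball x (r / 2)) (\<lambda>y. ennreal ((norm (w y))\<^sup>2)) = avg (ball x (r / 2)) (\<lambda>y. ennreal (V y))"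
      using in_ball(2) by (intro avg_ball_cong) auto
    finally show ?thesis .
  qed
  show "\<exists>D V. D \<in> borel_measurable lebesgue \<and> V \<in> borel_measurable lebesgue \<and>
        (\<forall>y\<in>ball x (r / 2). ennreal \<bar>grad2 y\<bar> \<le> 2 * D y + 2 * V y \<and> V y \<le> 2 * ennreal \<bar>grad2 y\<bar> + 2 * D y) \<and>
        avg (ball x (r / 2)) D < \<delta> \<and>
        (\<forall>y\<in>ball x (r / 4). unit_mean V y \<le> ennreal (K y) * avg (ball x (r / 2)) V)"
    using D_meas V_meas ineq D\<delta> VK by blast
qed

lemma level_set_empty:
  fixes \<phi> :: "'a::euclidean_space \<Rightarrow> real"
  assumes "\<phi> \<in> borel_measurable (lebesgue_on (ball 0 R))" "1 \<le> R"
    and zero: "coarse_norm 1 1 (ball 0 R) (zero_ext (ball 0 R) \<phi>) = 0"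
  shows "level_set (\<lambda>y. ennreal \<bar>zero_ext (ball 0 R) \<phi> y\<bar>) R t = {}"
proof -
  define G where "G = (\<lambda>y. ennreal \<bar>zero_ext (ball 0 R) \<phi> y\<bar>)"
  have "zero_ext (ball 0 R) \<phi> \<in> borel_measurable lebesgue"
    using assms(1) by (intro zero_ext_measurable) auto
  then have G: "G \<in> borel_measurable lebesgue" unfolding G_def by measurable
  have "(\<integral>\<^sup>+x\<in>ball 0 R. unit_mean G x \<partial>lebesgue) \<le> 0 * emeasure lebesgue (ball (0::'a) R)"
    using zero assms(2) avg_ball_le_iff[of R "0::'a" "unit_mean G" 0]
    unfolding coarse_norm_1_1 G_def by simp
  then have "(\<integral>\<^sup>+x\<in>ball 0 R. G x \<partial>lebesgue) = 0"
    using ball_integral_le_unit_mean_same[OF G assms(2)] by simp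
  moreover have "(\<integral>\<^sup>+y\<in>ball x r. G y \<partial>lebesgue) \<le> (\<integral>\<^sup>+y\<in>ball 0 R. G y \<partial>lebesgue)" for x r
    by (intro nn_integral_mono) (auto simp: G_def zero_ext_def indicator_def)
  ultimately have "avg (ball x r) G = 0" for x r
    by (simp add: avg_def)
  then show ?thesis by (simp add: level_set_def G_def[symmetric])
qed

text \<open>The order of choice matters: \<open>c\<close> is fixed first, to absorb the term that comes from the induction
hypothesis, and \<open>C\<close> then compensates for the loss of a power of \<open>1 / c\<close>.\<close>

lemma decay_constants:
  fixes p s :: real and N :: nat
  obtains c C where "0 < c" "3 * (160 ^ N * (48 * 8 ^ N) powr s) * c = 1"
    "3 * 10 ^ N \<le> C" "3 * 10 ^ N * (2 * 2 ^ N * (48 * 4 ^ N) / c) powr (p / 2) \<le> C"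
    "(160 ^ N * (48 * 4 ^ N)) powr (2 * s) \<le> C"
proof
  define c where "c = 1 / (3 * (160 ^ N * (48 * 8 ^ N) powr s))"
  show "0 < c" "3 * (160 ^ N * (48 * 8 ^ N) powr s) * c = 1" by (auto simp: c_def)
  let ?a = "3 * 10 ^ N :: real" and ?b = "3 * 10 ^ N * (2 * 2 ^ N * (48 * 4 ^ N) / c) powr (p / 2)"
    and ?d = "(160 ^ N * (48 * 4 ^ N)) powr (2 * s)"
  have "0 \<le> ?a" "0 \<le> ?b" "0 \<le> ?d" by auto
  then show "?a \<le> ?a + ?b + ?d" "?b \<le> ?a + ?b + ?d" "?d \<le> ?a + ?b + ?d" by linarith+
qed

theorem proposition2p2:
  fixes p q :: real
  assumes "CARD('n::finite) \<ge> 2" and "2 < p" and "p < q"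
  shows "\<exists>C::real. C \<ge> 1 \<and>
    (\<forall>(R::real) (f :: real ^ 'n \<Rightarrow> real) (u :: real ^ 'n \<Rightarrow> real) (K :: real ^ 'n \<Rightarrow> real).
       R \<ge> 10 \<longrightarrow> f \<in> L2 (ball 0 R) \<longrightarrow> u \<in> H1 (ball 0 R) \<longrightarrow>
       K \<in> borel_measurable lebesgue \<longrightarrow> (\<forall>x. K x \<ge> 1) \<longrightarrow>
       (\<forall>r\<in>{4..R / 2}. \<forall>x0\<in>ball 0 (R / 2).
          (INF v\<in>class_A x0 (r / 2) K.
             avg (ball x0 (r / 2)) (\<lambda>x. ennreal ((norm
               (weak_grad (ball 0 R) u x - weak_grad (ball x0 (r / 2)) v x))\<^sup>2)))
          \<le> avg (ball x0 r) (\<lambda>x. ennreal (\<bar>f x\<bar>\<^sup>2))) \<longrightarrow>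
       (let grad2 = zero_ext (ball 0 R) (\<lambda>x. (norm (weak_grad (ball 0 R) u x))\<^sup>2);
            f2 = zero_ext (ball 0 R) (\<lambda>x. (f x)\<^sup>2);
            \<theta> = (p\<^sup>2 + 2 * p) / (p\<^sup>2 + 2 * q);
            t_star = coarse_norm 1 1 (ball 0 R) grad2 + coarse_norm 1 (p / 2) (ball 0 R) f2
        in 0 < \<theta> \<and> \<theta> < 1 \<and> (\<forall>t::real. t > 0 \<longrightarrow>
             emeasure lebesgue {x \<in> ball 0 (R / 2). coarse_maximal 1 grad2 x > ennreal t}
             \<le> ennreal C * emeasure lebesgue (ball (0 :: real ^ 'n) (R / 2))
                 * epowr (ennreal t / t_star) (- (p / 2 * (1 - \<theta>)))
                 * epowr (coarse_norm 1 1 (ball 0 R) (\<lambda>x. K x powr (q / 2))) \<theta>)))"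
proof -
  define s where "s = p * (q - p) / (p\<^sup>2 + 2 * q)"
  define \<theta> where "\<theta> = (p\<^sup>2 + 2 * p) / (p\<^sup>2 + 2 * q)"
  note exps = decay_exponent[OF assms(2,3), folded s_def \<theta>_def]
  obtain c C where c: "0 < c" "3 * (160 ^ DIM(real ^ 'n) * (48 * 8 ^ DIM(real ^ 'n)) powr s) * c = 1"
    and C: "3 * 10 ^ DIM(real ^ 'n) \<le> C"
      "3 * 10 ^ DIM(real ^ 'n) * (2 * 2 ^ DIM(real ^ 'n) * (48 * 4 ^ DIM(real ^ 'n)) / c) powr (p / 2) \<le> C"
      "(160 ^ DIM(real ^ 'n) * (48 * 4 ^ DIM(real ^ 'n))) powr (2 * s) \<le> C"
    by (rule decay_constants)
  have C1: "1 \<le> C"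
  proof -
    have "(1::real) \<le> 10 ^ DIM(real ^ 'n)" by (rule one_le_power) simp
    then show ?thesis using C(1) by linarith
  qed
  have bound: "emeasure lebesgue {x \<in> ball 0 (R / 2). coarse_maximal 1 grad2 x > ennreal t}
             \<le> ennreal C * emeasure lebesgue (ball (0 :: real ^ 'n) (R / 2))
                 * epowr (ennreal t / t_star) (- s) * epowr \<kappa> \<theta>"
    if R: "R \<ge> 10" and f: "f \<in> L2 (ball 0 R)" and u: "u \<in> H1 (ball 0 R)"
      and K: "K \<in> borel_measurable lebesgue" "\<And>x. K x \<ge> 1"
      and approx: "\<And>r x0. r \<in> {4..R / 2} \<Longrightarrow> x0 \<in> ball 0 (R / 2) \<Longrightarrow>
          (INF v\<in>class_A x0 (r / 2) K.
             avg (ball x0 (r / 2)) (\<lambda>x. ennreal ((norm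
               (weak_grad (ball 0 R) u x - weak_grad (ball x0 (r / 2)) v x))\<^sup>2)))
          \<le> avg (ball x0 r) (\<lambda>x. ennreal (\<bar>f x\<bar>\<^sup>2))"
      and grad2: "grad2 = zero_ext (ball 0 R) (\<lambda>x. (norm (weak_grad (ball 0 R) u x))\<^sup>2)"
      and f2: "f2 = zero_ext (ball 0 R) (\<lambda>x. (f x)\<^sup>2)"
      and t_star: "t_star = coarse_norm 1 1 (ball 0 R) grad2 + coarse_norm 1 (p / 2) (ball 0 R) f2"
      and \<kappa>: "\<kappa> = coarse_norm 1 1 (ball 0 R) (\<lambda>x. K x powr (q / 2))"
      and t: "0 < t"
    for R t :: real and f u K grad2 f2 :: "real ^ 'n \<Rightarrow> real" and t_star \<kappa> :: ennreal
  proof -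
    have vol0: "emeasure lebesgue (ball (0 :: real ^ 'n) (R / 2)) \<noteq> 0"
      using R by (intro emeasure_ball_pos_finite) auto
    have \<kappa>1: "1 \<le> \<kappa>"
    proof -
      have "1 \<le> unit_mean (\<lambda>y. ennreal \<bar>K y powr (q / 2)\<bar>) x" for x
      proof -
        have "avg (ball x 1) (\<lambda>_. 1) \<le> avg (ball x 1) (\<lambda>y. ennreal \<bar>K y powr (q / 2)\<bar>)"
          using K(2) assms by (intro avg_ball_mono) (auto intro!: ge_one_powr_ge_zero)
        then show ?thesis by (simp add: avg_ball_const unit_mean_def)
      qed
      then have "avg (ball (0 :: real ^ 'n) R) (\<lambda>_. 1) \<le> \<kappa>"
        unfolding \<kappa> coarse_norm_1_1 by (intro avg_ball_mono) auto
      then show ?thesis using R by (simp add: avg_ball_const)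
    qed
    have \<kappa>\<theta>: "epowr \<kappa> \<theta> \<noteq> 0"
    proof (cases \<kappa>)
      case (real k)
      then show ?thesis using \<kappa>1 exps by (simp add: epowr_ennreal)
    next
      case top
      then show ?thesis using exps by (simp add: epowr_pos)
    qed
    \<comment> \<open>The degenerate values of \<open>t\<^sub>*\<close> are treated separately: if it vanishes so does \<open>\<nabla>u\<close>,
      and if it is infinite so is the right-hand side.\<close>
    note level = level_set_coarse_maximal[of R t grad2]
    consider "t_star = 0" | "t_star = top" | ts where "t_star = ennreal ts" "0 < ts"
      by (cases t_star) (auto simp: ennreal_eq_0_iff not_le less_le)
    then show ?thesis
    proof cases
      case 1
      have "(\<lambda>x. (norm (weak_grad (ball 0 R) u x))\<^sup>2) \<in> borel_measurable (lebesgue_on (ball 0 R))"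
        using u by (auto simp: H1_def L2_def)
      then show ?thesis
        using 1 R unfolding level unfolding t_star grad2 by (subst level_set_empty) auto
    next
      case 2
      have "epowr (ennreal t / t_star) (- s) = top"
        using 2 exps(1) by (simp add: epowr_def Let_def)
      then show ?thesis using vol0 \<kappa>\<theta> C1
        by (simp add: ennreal_mult_eq_top_iff ennreal_top_mult ennreal_mult_top)
    next
      case 3
      have pow: "epowr (ennreal t / t_star) (- s) = ennreal ((t / ts) powr (- s))"
        using 3 exps(1) t by (simp add: divide_ennreal epowr_def Let_def inverse_ennreal powr_minus)
      show ?thesis
      proof (cases \<kappa>)
        case (real k)
        have "coarse_comparison (\<lambda>y. ennreal \<bar>grad2 y\<bar>) (\<lambda>y. ennreal \<bar>f2 y\<bar>) (\<lambda>y. ennreal (K y)) R p q ts k"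
          unfolding grad2 f2
        proof (rule coarse_comparison_gradient[OF R assms(2,3) 3(2) _ f u K approx])
          show "1 \<le> k" using \<kappa>1 real by simp
          show "coarse_norm 1 1 (ball 0 R) (zero_ext (ball 0 R) (\<lambda>x. (norm (weak_grad (ball 0 R) u x))\<^sup>2)) \<le> ennreal ts"
            unfolding 3(1)[symmetric] t_star grad2 by simp
          show "coarse_norm 1 (p / 2) (ball 0 R) (zero_ext (ball 0 R) (\<lambda>x. (f x)\<^sup>2)) \<le> ennreal ts"
            unfolding 3(1)[symmetric] t_star f2 by simp
          show "coarse_norm 1 1 (ball 0 R) (\<lambda>x. K x powr (q / 2)) \<le> ennreal k"
            using \<kappa> real by simp
        qed
        then interpret coarse_comparison "\<lambda>y. ennreal \<bar>grad2 y\<bar>" "\<lambda>y. ennreal \<bar>f2 y\<bar>"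
          "\<lambda>y. ennreal (K y)" R p q ts k .
        obtain W where W: "W \<in> sets lebesgue" "level_set (\<lambda>y. ennreal \<bar>grad2 y\<bar>) R (t / ts * ts) \<subseteq> W"
          "emeasure lebesgue W \<le> ennreal (C * k powr \<theta> * (t / ts) powr (- s)) * emeasure lebesgue (ball (0 :: real ^ 'n) (R / 2))"
          using level_set_decay[OF exps(1,4,2,3,5,6) c C, of "t / ts"] t 3(2) by auto
        have "emeasure lebesgue {x \<in> ball 0 (R / 2). coarse_maximal 1 grad2 x > ennreal t} \<le> emeasure lebesgue W"
          unfolding level using W(1,2) 3(2) by (intro emeasure_mono) auto
        also note W(3)
        also have "ennreal (C * k powr \<theta> * (t / ts) powr (- s)) * emeasure lebesgue (ball (0 :: real ^ 'n) (R / 2))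
          = ennreal C * emeasure lebesgue (ball (0 :: real ^ 'n) (R / 2)) * ennreal ((t / ts) powr (- s)) * ennreal (k powr \<theta>)"
          using C1 by (simp add: ennreal_mult mult_ac)
        also have "ennreal (k powr \<theta>) = epowr \<kappa> \<theta>"
          using real exps by (simp add: epowr_ennreal)
        finally show ?thesis unfolding pow .
      next
        case top
        then have "epowr \<kappa> \<theta> = top" using exps by (simp add: epowr_pos)
        moreover have "0 < (t / ts) powr (- s)" using t 3(2) by simp
        ultimately show ?thesis using vol0 C1 unfolding pow
          by (simp add: ennreal_mult_eq_top_iff ennreal_top_mult ennreal_mult_top)
      qed
    qed
  qed
  show ?thesis
    unfolding Let_def \<theta>_def[symmetric] exps(4)[symmetric]
    using C1 exps(2,3) bound by (intro exI[of _ C] conjI allI impI) auto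
qed

end
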